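(* Let $p\ge3$ be a prime, and let $f\colon\mathbb F_p^2\to\mathbb C$ be a nonzero function. Write $S:=\operatorname{supp} f\subseteq\mathbb F_p^2$ and $X:=\operatorname{supp}\hat f\subseteq\widehat{\mathbb F_p^2}$. Then either $$\frac1{p-2}\,\min\{|S|,|X|\}+\frac13\,\max\{|S|,|X|\}\ge p+1,$$ or $$\min\{|S|,|X|\}\ge\frac32(p-1),$$ except if the smallest of the sets $S$ and $X$ is a coset of a nonzero, proper subgroup of the corresponding group, possibly with one element missing, and the largest is either a coset, or a union of two cosets, of the orthogonal subgroup.
   Context: $\mathbb F_p^2$ is regarded as an additive group $G$; $\widehat G$ is its group of complex characters. For $f\colon G\to\mathbb C$, the Fourier transform $\hat f\colon\widehat G\to\mathbb C$ is $\hat f(\chi)=\frac1{|G|}\sum_{g\in G}f(g)\overline{\chi(g)}$. The corresponding group is $\mathbb F_p^2$ for $S$ and $\widehat{\mathbb F_p^2}$ for $X$. For a subgroup $H\le G$, the orthogonal subgroup is $H^\perp:=\{\chi\in\widehat G\colon H\le\ker\chi\}\le\widehat G$; for a subgroup $F\le\widehat G$, the orthogonal subgroup is $F^\perp:=\bigcap_{\chi\in F}\ker\chi\le G$. The support $\operatorname{supp}$ of a function is the set of points where it is nonzero. *)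

theory Defs
  imports
    Complex_Main
    "HOL-Library.Product_Plus"
    "HOL-Algebra.Coset"
    "Berlekamp_Zassenhaus.Finite_Field"
begin

definition additive_group :: "'a::ab_group_add monoid" where
  "additive_group = \<lparr>carrier = UNIV, monoid.mult = (+), one = 0\<rparr>"

definition complex_units :: "complex monoid" where
  "complex_units = \<lparr>carrier = - {0}, monoid.mult = (*), one = 1\<rparr>"

definition dual_group :: "('a::ab_group_add \<Rightarrow> complex) monoid" where
  "dual_group = \<lparr>carrier = hom additive_group complex_units,
                 monoid.mult = (\<lambda>\<chi> \<psi> g. \<chi> g * \<psi> g), one = (\<lambda>_. 1)\<rparr>"

lemma comm_group_additive_group: "comm_group (additive_group :: 'a::ab_group_add monoid)"
  by (rule comm_groupI)
    (auto simp: additive_group_def algebra_simps intro: exI[of _ "- x" for x])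

lemma comm_group_complex_units: "comm_group complex_units"
proof (rule comm_groupI)
  fix x assume "x \<in> carrier complex_units"
  then show "\<exists>y\<in>carrier complex_units. y \<otimes>\<^bsub>complex_units\<^esub> x = \<one>\<^bsub>complex_units\<^esub>"
    by (intro bexI[of _ "inverse x"]) (auto simp: complex_units_def)
qed (auto simp: complex_units_def)

lemma comm_group_dual_group: "comm_group (dual_group :: ('a::ab_group_add \<Rightarrow> complex) monoid)"
proof (rule comm_groupI)
  fix \<chi> :: "'a \<Rightarrow> complex" assume "\<chi> \<in> carrier dual_group"
  then show "\<exists>\<psi>\<in>carrier dual_group. \<psi> \<otimes>\<^bsub>dual_group\<^esub> \<chi> = \<one>\<^bsub>dual_group\<^esub>"
    by (intro bexI[of _ "\<lambda>g. inverse (\<chi> g)"])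
      (auto simp: dual_group_def hom_def additive_group_def complex_units_def Pi_iff fun_eq_iff)
qed (auto simp: dual_group_def hom_def additive_group_def complex_units_def Pi_iff fun_eq_iff)

definition fourier :: "('a::{finite,ab_group_add} \<Rightarrow> complex) \<Rightarrow> ('a \<Rightarrow> complex) \<Rightarrow> complex" where
  "fourier f \<chi> = 1 / of_nat CARD('a) * (\<Sum>g\<in>UNIV. f g * cnj (\<chi> g))"

definition supp_on :: "'a set \<Rightarrow> ('a \<Rightarrow> complex) \<Rightarrow> 'a set" where
  "supp_on A f = {x \<in> A. f x \<noteq> 0}"

definition orth :: "'a::ab_group_add set \<Rightarrow> ('a \<Rightarrow> complex) set" where
  "orth H = {\<chi> \<in> carrier dual_group. H \<subseteq> kernel additive_group complex_units \<chi>}"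

definition dual_orth :: "('a::ab_group_add \<Rightarrow> complex) set \<Rightarrow> 'a set" where
  "dual_orth F = (\<Inter>\<chi>\<in>F. kernel additive_group complex_units \<chi>)"

definition coset_up_to_one :: "('a, 'b) monoid_scheme \<Rightarrow> 'a set \<Rightarrow> 'a set \<Rightarrow> bool" where
  "coset_up_to_one G H A \<longleftrightarrow>
     A \<in> rcosets\<^bsub>G\<^esub> H \<or> (\<exists>C \<in> rcosets\<^bsub>G\<^esub> H. \<exists>c \<in> C. A = C - {c})"

definition one_or_two_cosets :: "('a, 'b) monoid_scheme \<Rightarrow> 'a set \<Rightarrow> 'a set \<Rightarrow> bool" where
  "one_or_two_cosets G H A \<longleftrightarrow>
     A \<in> rcosets\<^bsub>G\<^esub> H \<or> (\<exists>C \<in> rcosets\<^bsub>G\<^esub> H. \<exists>D \<in> rcosets\<^bsub>G\<^esub> H. C \<noteq> D \<and> A = C \<union> D)"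

text \<open>In the following predicate, \<open>A\<close> lives in \<open>G\<close> and \<open>B\<close> in the dual of \<open>G\<close>, or the other way
  round; \<open>perp\<close> maps subgroups of the group of \<open>A\<close> to subgroups of the group of \<open>B\<close>.\<close>

definition coset_pair ::
  "('a, 'c) monoid_scheme \<Rightarrow> ('b, 'd) monoid_scheme \<Rightarrow> ('a set \<Rightarrow> 'b set) \<Rightarrow> 'a set \<Rightarrow> 'b set \<Rightarrow> bool"
where
  "coset_pair G G' perp A B \<longleftrightarrow>
     (\<exists>H. subgroup H G \<and> H \<noteq> {\<one>\<^bsub>G\<^esub>} \<and> H \<noteq> carrier G \<and>
          coset_up_to_one G H A \<and> one_or_two_cosets G' (perp H) B)"

end

theory Submission
  imports Defs "Jordan_Normal_Form.Determinant"
begin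

text \<open>
  Restricting \<open>f\<close> to a line amounts to projecting its transform along the orthogonal direction, so
  Tao's inequality \<open>|supp f| + |supp f^| \<ge> p + 1\<close> on \<open>F_p\<close> shows that every line meeting one of the two
  supports contains at least \<open>p + 1 - m\<close> of its points, where \<open>m\<close> is the number of lines of the
  orthogonal direction that meet the other support.

  Let \<open>S\<close> be the smaller support and \<open>|S| < 3(p - 1)/2\<close>. If \<open>S\<close> lies on a line, the other support
  is a union of \<open>N \<ge> p + 1 - |S|\<close> parallel lines: \<open>N \<ge> 3\<close> gives the inequality and \<open>N \<le> 2\<close> the exceptional
  case. Otherwise some direction has at least two lines missing \<open>S\<close>, and counting points on the
  lines of this direction gives the inequality. To find such a direction, suppose that \<open>S\<close> misses at
  most one line \<open>x = c(y)\<close> of each slope \<open>y\<close>. The power sums over \<open>x\<close> of the Redei polynomial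
  \<open>\<Prod>(x - b + ay)\<close> are polynomials of small degree in \<open>y\<close> which are geometric progressions with ratio
  \<open>c(y)\<close>; this forces \<open>c\<close> to be linear, so that all missed lines pass through one point. Hence two
  points turn \<open>S\<close> into an affine blocking set, contradicting the Jamison--Brouwer--Schrijver bound
  \<open>2p - 1\<close>.
\<close>

section \<open>Polynomial functions on a prime field\<close>

lemma bij_betw_of_nat_mod_ring:
  "bij_betw (of_nat :: nat \<Rightarrow> 'p::prime_card mod_ring) {..<CARD('p)} UNIV"
proof -
  have s: "(of_nat :: nat \<Rightarrow> 'p mod_ring) ` {..<CARD('p)} = UNIV"
    using surj_of_nat_mod_ring by blast
  then have "inj_on (of_nat :: nat \<Rightarrow> 'p mod_ring) {..<CARD('p)}"
    by (intro eq_card_imp_inj_on) auto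
  then show ?thesis using s by (simp add: bij_betw_def)
qed

lemma card_mod_ring_gt_1: "CARD('p::prime_card) > 1"
  using prime_card[where 'a = 'p] prime_gt_1_nat by blast

lemma poly_eq_0_if_vanishes:
  fixes P :: "'p::prime_card mod_ring poly"
  assumes "degree P < CARD('p)" and "\<And>x. poly P x = 0"
  shows "P = 0"
proof (rule ccontr)
  assume "P \<noteq> 0"
  then have "card {x. poly P x = 0} \<le> degree P" by (rule card_poly_roots_bound)
  then show False using assms by simp
qed

lemma power_card_minus_1:
  fixes x :: "'p::prime_card mod_ring"
  shows "x \<noteq> 0 \<Longrightarrow> x ^ (CARD('p) - 1) = 1"
proof -
  assume "x \<noteq> 0"
  have "x * x ^ (CARD('p) - 1) = x"
    using finite_field_power_card_eq_same[of x] card_mod_ring_gt_1[where 'p = 'p]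
    by (simp flip: power_Suc)
  then show ?thesis using \<open>x \<noteq> 0\<close> by simp
qed

text \<open>For \<open>i > 0\<close> the polynomial \<open>x ^ i - 1\<close> has too few roots to
  contain all nonzero elements, so some nonzero \<open>g\<close> has
  \<open>g ^ i \<noteq> 1\<close>. Replacing \<open>x\<close> by \<open>g * x\<close> permutes the
  field and multiplies the sum by \<open>g ^ i\<close>. For \<open>i = 0\<close> the sum counts the
  field, which is zero in it.\<close>

lemma sum_power_low:
  assumes "i < CARD('p::prime_card) - 1"
  shows "(\<Sum>x\<in>UNIV. x ^ i) = (0 :: 'p mod_ring)"
proof (cases "i = 0")
  case False
  have "\<exists>g::'p mod_ring. g \<noteq> 0 \<and> g ^ i \<noteq> 1"
  proof (rule ccontr)
    assume "\<not> ?thesis"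
    then have "- {0} \<subseteq> {x::'p mod_ring. poly (monom 1 i - 1) x = 0}"
      by (auto simp: poly_monom)
    then have "card (- {0::'p mod_ring}) \<le> card {x::'p mod_ring. poly (monom 1 i - 1) x = 0}"
      by (intro card_mono) auto
    also have "\<dots> \<le> degree (monom 1 i - 1 :: 'p mod_ring poly)"
    proof (rule card_poly_roots_bound)
      have "coeff (monom 1 i :: 'p mod_ring poly) i \<noteq> coeff 1 i"
        using False by simp
      then show "(monom 1 i - 1 :: 'p mod_ring poly) \<noteq> 0" by (metis eq_iff_diff_eq_0)
    qed
    also have "\<dots> \<le> i" by (rule degree_diff_le) (auto simp: degree_monom_le)
    finally show False using assms by (simp add: Compl_eq_Diff_UNIV card_Diff_singleton)
  qed
  then obtain g :: "'p mod_ring" where g: "g \<noteq> 0" "g ^ i \<noteq> 1" by blast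
  let ?s = "\<Sum>x\<in>UNIV. x ^ i :: 'p mod_ring"
  have "?s = (\<Sum>x\<in>UNIV. (g * x) ^ i)"
    by (rule sum.reindex_bij_witness[of _ "\<lambda>x. g * x" "\<lambda>x. x / g"]) (use g in auto)
  also have "\<dots> = g ^ i * ?s" by (simp add: power_mult_distrib sum_distrib_left)
  finally have "(1 - g ^ i) * ?s = 0" by (simp add: algebra_simps)
  then show ?thesis using g by simp
qed simp

lemma sum_power_card_minus_1: "(\<Sum>x\<in>UNIV. x ^ (CARD('p::prime_card) - 1)) = (- 1 :: 'p mod_ring)"
proof -
  have "(\<Sum>x\<in>UNIV. x ^ (CARD('p) - 1)) = (\<Sum>x\<in>UNIV - {0::'p mod_ring}. 1 :: 'p mod_ring)"
    using card_mod_ring_gt_1[where 'p = 'p]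
    by (intro sum.mono_neutral_cong_right) (auto simp: power_card_minus_1[simplified])
  also have "\<dots> = -1"
    using card_mod_ring_gt_1[where 'p = 'p] by (simp add: card_Diff_singleton of_nat_diff)
  finally show ?thesis .
qed

lemma sum_power:
  assumes "i < 2 * (CARD('p::prime_card) - 1)"
  shows "(\<Sum>x\<in>UNIV. x ^ i) = (if i = CARD('p) - 1 then - 1 else 0 :: 'p mod_ring)"
proof -
  consider "i < CARD('p) - 1" | "i = CARD('p) - 1" | "i \<ge> CARD('p)" using assms by linarith
  then show ?thesis
  proof cases
    case 3
    \<comment> \<open>The reduced exponent is still positive, so this holds at \<open>x = 0\<close>
      too.\<close>
    have "x ^ i = x ^ (i - (CARD('p) - 1))" for x :: "'p mod_ring"
    proof -
      have "x ^ i = x ^ CARD('p) * x ^ (i - CARD('p))" using 3 by (simp flip: power_add)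
      also have "\<dots> = x ^ (i - (CARD('p) - 1))"
        using finite_field_power_card_eq_same[of x] 3 by (simp flip: power_Suc add: Suc_diff_le)
      finally show ?thesis .
    qed
    then have "(\<Sum>x\<in>UNIV. x ^ i) = (\<Sum>x\<in>UNIV. x ^ (i - (CARD('p) - 1)) :: 'p mod_ring)" by simp
    also have "\<dots> = 0" by (rule sum_power_low) (use assms 3 in simp)
    finally show ?thesis using 3 card_mod_ring_gt_1[where 'p = 'p] by simp
  qed (auto simp: sum_power_low sum_power_card_minus_1[simplified])
qed

text \<open>Summation over the field extracts a coefficient: the degree bound leaves
  \<open>CARD('p) - 1\<close> as the only exponent with a nonzero power sum.\<close>

lemma sum_poly_power:
  fixes q :: "'p::prime_card mod_ring poly"
  assumes "degree q + j < 2 * (CARD('p) - 1)" "j < CARD('p)"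
  shows "(\<Sum>x\<in>UNIV. poly q x * x ^ j) = - coeff q (CARD('p) - 1 - j)"
proof -
  have "(\<Sum>x\<in>UNIV. poly q x * x ^ j) = (\<Sum>i\<le>degree q. coeff q i * (\<Sum>x\<in>UNIV. x ^ (i + j)))"
    unfolding poly_altdef sum_distrib_right sum_distrib_left
    by (subst sum.swap) (simp add: power_add mult_ac)
  also have "\<dots> = (\<Sum>i\<le>degree q. if i = CARD('p) - 1 - j then - coeff q i else 0)"
    using assms by (intro sum.cong refl) (subst sum_power, auto)
  also have "\<dots> = - coeff q (CARD('p) - 1 - j)"
    by (auto simp: sum.delta coeff_eq_0)
  finally show ?thesis .
qed

text \<open>The function \<open>1 - (x - r) ^ (CARD('p) - 1)\<close> is the indicator of the point
  \<open>r\<close>.\<close>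

lemma interpolation_mod_ring:
  fixes u :: "'p::prime_card mod_ring \<Rightarrow> 'p mod_ring"
  obtains U where "degree U < CARD('p)" "\<And>x. poly U x = u x"
proof
  let ?U = "\<Sum>r\<in>UNIV. smult (u r) (1 - [:-r, 1:] ^ (CARD('p) - 1))"
  have "degree ?U \<le> CARD('p) - 1"
  proof (rule degree_sum_le)
    fix r :: "'p mod_ring"
    have "degree ([:-r, 1:] ^ (CARD('p) - 1)) \<le> CARD('p) - 1" 
      using degree_power_le[of "[:-r, 1:]" "CARD('p) - 1"] by simp
    then show "degree (smult (u r) (1 - [:-r, 1:] ^ (CARD('p) - 1))) \<le> CARD('p) - 1"
      by (intro order.trans[OF degree_smult_le] degree_diff_le) auto
  qed simp
  then show "degree ?U < CARD('p)" using card_mod_ring_gt_1[where 'p = 'p] by simp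
  fix x
  have "poly ?U x = (\<Sum>r\<in>UNIV. if r = x then u r else 0)"
    unfolding poly_sum using card_mod_ring_gt_1[where 'p = 'p]
    by (intro sum.cong refl) (auto simp: power_card_minus_1[simplified])
  then show "poly ?U x = u x" by simp
qed

section \<open>Uncertainty on a prime field\<close>

text \<open>The determinant is formed in the common ring and commutes with both homomorphisms, so
  singularity passes from one field to the other. This carries a complex linear dependency to
  characteristic \<open>p\<close>.\<close>

lemma kernel_transfer:
  fixes \<phi> :: "'r::comm_ring_1 \<Rightarrow> 'k::field" and \<psi> :: "'r \<Rightarrow> 'l::field"
    and M :: "nat \<Rightarrow> nat \<Rightarrow> 'r"
  assumes \<phi>: "comm_ring_hom \<phi>" and \<psi>: "comm_ring_hom \<psi>"
    and ker: "\<And>d. \<phi> d = 0 \<Longrightarrow> \<psi> d = 0"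
    and v: "\<And>i. i < n \<Longrightarrow> (\<Sum>j<n. \<phi> (M i j) * v j) = 0" and j: "j < n" "v j \<noteq> 0"
  shows "\<exists>u. (\<forall>i<n. (\<Sum>j<n. \<psi> (M i j) * u j) = 0) \<and> (\<exists>j<n. u j \<noteq> 0)"
proof -
  let ?M = "mat n n (\<lambda>(i, j). M i j)"
  interpret \<phi>: comm_ring_hom \<phi> by (rule \<phi>)
  interpret \<psi>: comm_ring_hom \<psi> by (rule \<psi>)
  have c\<phi>: "map_mat \<phi> ?M \<in> carrier_mat n n" and c\<psi>: "map_mat \<psi> ?M \<in> carrier_mat n n" by auto
  have "map_mat \<phi> ?M *\<^sub>v vec n v = 0\<^sub>v n"
    using v by (intro eq_vecI) (auto simp: scalar_prod_def lessThan_atLeast0)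
  moreover have "vec n v \<noteq> 0\<^sub>v n"
    using j by (metis index_vec index_zero_vec(1))
  ultimately have "det (map_mat \<phi> ?M) = 0"
    unfolding det_0_iff_vec_prod_zero_field[OF c\<phi>] by (intro exI[of _ "vec n v"]) auto
  then have "det (map_mat \<psi> ?M) = 0" using ker by simp
  then obtain w where w: "w \<in> carrier_vec n" "w \<noteq> 0\<^sub>v n" "map_mat \<psi> ?M *\<^sub>v w = 0\<^sub>v n"
    unfolding det_0_iff_vec_prod_zero_field[OF c\<psi>] by auto
  have "(\<Sum>j<n. \<psi> (M i j) * w $ j) = 0" if i: "i < n" for i
  proof -
    have "(map_mat \<psi> ?M *\<^sub>v w) $ i = 0" using w i by simp
    then show ?thesis using i w(1) by (auto simp: scalar_prod_def lessThan_atLeast0)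
  qed
  moreover have "\<exists>j<n. w $ j \<noteq> 0" using w(1,2) by (metis carrier_vecD eq_vecI index_zero_vec)
  ultimately show ?thesis by (intro exI[of _ "\<lambda>j. w $ j"]) blast
qed

text \<open>As \<open>1\<close> generates the additive group, the condition at \<open>1\<close> is
  nontriviality.\<close>

definition add_char :: "('p::prime_card mod_ring \<Rightarrow> complex) \<Rightarrow> bool" where
  "add_char e \<longleftrightarrow> (\<forall>x y. e (x + y) = e x * e y) \<and> e 0 = 1 \<and> e 1 \<noteq> 1"

context
  fixes e :: "'p::prime_card mod_ring \<Rightarrow> complex"
  assumes e: "add_char e"
begin

lemma e_add: "e (x + y) = e x * e y" and e_0: "e 0 = 1" and e_1: "e 1 \<noteq> 1"
  using e unfolding add_char_def by auto

lemma e_of_nat: "e (of_nat n) = e 1 ^ n"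
  by (induction n) (auto simp: e_0 e_add)

lemma e_mult_of_nat: "e (of_nat n * x) = e x ^ n"
  by (induction n) (auto simp: e_0 e_add algebra_simps)

lemma e_nonzero: "e x \<noteq> 0"
  using e_add[of x "-x"] e_0 by auto

lemma e_eq_1: assumes "e x = 1" shows "x = 0"
proof (rule ccontr)
  assume "x \<noteq> 0"
  obtain n where "1 / x = (of_nat n :: 'p mod_ring)" using surj_of_nat_mod_ring by blast
  then have "of_nat n * x = 1" using \<open>x \<noteq> 0\<close> by (metis nonzero_eq_divide_eq)
  then have "e 1 = 1" using e_mult_of_nat[of n x] assms by simp
  then show False using e_1 by simp
qed

lemma sum_e_mult: "(\<Sum>x\<in>UNIV. e (x * y)) = (if y = 0 then of_nat CARD('p) else 0)"
proof (cases "y = 0")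
  case False
  let ?s = "\<Sum>x\<in>UNIV. e (x * y)"
  have "?s = (\<Sum>x\<in>UNIV. e ((x + 1) * y))"
    by (rule sum.reindex_bij_witness[of _ "\<lambda>x. x + 1" "\<lambda>x. x - 1"]) auto
  also have "\<dots> = ?s * e y" by (simp add: algebra_simps e_add sum_distrib_left)
  finally have "?s * (e y - 1) = 0" by (simp add: algebra_simps)
  then show ?thesis using e_eq_1[of y] False by auto
qed (simp add: e_0)

text \<open>
  The circulant matrix \<open>M\<close> of \<open>q\<close> kills the vector of the values of \<open>e\<close>, so it is singular modulo \<open>p\<close>
  as well. But modulo \<open>p\<close> every vector is a polynomial \<open>U\<close> of degree less than \<open>p\<close>, and the circulant
  multiplies the leading coefficient of \<open>U\<close> by \<open>q(1)\<close>.
\<close>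

lemma cyclotomic_mod_p:
  fixes q :: "int poly"
  assumes "poly (map_poly of_int q) (e 1) = 0"
  shows "poly (map_poly of_int q) (1 :: 'p mod_ring) = 0"
proof (rule ccontr)
  assume q1: "poly (map_poly of_int q) (1 :: 'p mod_ring) \<noteq> 0"
  define p where "p = CARD('p)"
  \<comment> \<open>The coefficients of \<open>q\<close> reduced modulo \<open>X ^ p - 1\<close>,
    indexed by residues; \<open>M\<close> is their circulant.\<close>
  define c where "c r = (\<Sum>n | n \<le> degree q \<and> of_nat n = (r :: 'p mod_ring). coeff q n)" for r
  define M where "M i j = c (of_nat j - of_nat i)" for i j
  have bij: "bij_betw (of_nat :: nat \<Rightarrow> 'p mod_ring) {..<p} UNIV"
    unfolding p_def by (rule bij_betw_of_nat_mod_ring)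
  have sum_c: "(\<Sum>r\<in>UNIV. of_int (c r) * g r) = (\<Sum>n\<le>degree q. of_int (coeff q n) * g (of_nat n))"
    for g :: "'p mod_ring \<Rightarrow> 'k::comm_ring_1"
  proof -
    have "(\<Sum>r\<in>UNIV. of_int (c r) * g r)
        = (\<Sum>r\<in>UNIV. \<Sum>n | n \<in> {..degree q} \<and> of_nat n = (r :: 'p mod_ring). of_int (coeff q n) * g (of_nat n))"
      by (intro sum.cong) (auto simp: c_def sum_distrib_right)
    also have "\<dots> = (\<Sum>n\<le>degree q. of_int (coeff q n) * g (of_nat n))"
      by (rule sum.group) auto
    finally show ?thesis .
  qed
  have row: "(\<Sum>j<p. of_int (M i j) * g (of_nat j)) = (\<Sum>r\<in>UNIV. of_int (c r) * g (of_nat i + r))"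
    for g :: "'p mod_ring \<Rightarrow> 'k::comm_ring_1" and i
  proof -
    have "(\<Sum>j<p. of_int (M i j) * g (of_nat j)) = (\<Sum>r\<in>UNIV. of_int (c (r - of_nat i)) * g r)"
      unfolding M_def by (rule sum.reindex_bij_betw[OF bij])
    also have "\<dots> = (\<Sum>r\<in>UNIV. of_int (c r) * g (of_nat i + r))"
      by (rule sum.reindex_bij_witness[of _ "\<lambda>r. r + of_nat i" "\<lambda>r. r - of_nat i"]) auto
    finally show ?thesis .
  qed
  have 0: "(\<Sum>j<p. complex_of_int (M i j) * e (of_nat j)) = 0" for i
  proof -
    have "(\<Sum>r\<in>UNIV. of_int (c r) * e r) = 0"
      using assms by (simp add: sum_c poly_altdef e_of_nat)
    then show ?thesis
      unfolding row e_add mult.left_commute[of _ "e (of_nat i)"] by (simp flip: sum_distrib_left)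
  qed
  have p0: "0 < p" by (simp add: p_def)
  have ker: "(of_int d :: 'p mod_ring) = 0" if "(of_int d :: complex) = 0" for d
    using that by simp
  from kernel_transfer[where M = M and v = "\<lambda>j. e (of_nat j)",
      OF of_int_hom.comm_ring_hom_axioms of_int_hom.comm_ring_hom_axioms ker 0 p0 e_nonzero]
  obtain u where u: "\<And>i. i < p \<Longrightarrow> (\<Sum>j<p. of_int (M i j) * u j) = 0"
    and u0: "\<exists>j<p. u j \<noteq> (0 :: 'p mod_ring)"
    by blast
  from interpolation_mod_ring[of "\<lambda>x. u (inv_into {..<p} of_nat x)"]
  obtain U where U: "degree U < p" "\<And>x. poly U x = u (inv_into {..<p} of_nat x)"
    unfolding p_def by blast
  have Uj: "poly U (of_nat j) = u j" if "j < p" for j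
    using that bij by (simp add: U(2) bij_betw_inv_into_left)
  have Unz: "U \<noteq> 0" using u0 Uj by auto
  \<comment> \<open>The circulant acts on polynomial functions as a combination of translations,
    which keep the degree and the leading coefficient. Hence \<open>W\<close> has degree below
    \<open>p\<close>, vanishes everywhere, and still shows \<open>lead_coeff U\<close> times the sum
    of the \<open>c r\<close>.\<close>
  define W where "W = (\<Sum>r\<in>UNIV. smult (of_int (c r)) (U \<circ>\<^sub>p [:r, 1:]))"
  have "poly W (of_nat i) = 0" if "i < p" for i
  proof -
    have "poly W (of_nat i) = (\<Sum>j<p. of_int (M i j) * poly U (of_nat j))"
      unfolding row by (simp add: W_def poly_sum poly_pcompose add.commute)
    also have "\<dots> = 0" using u[OF that] by (simp add: Uj)
    finally show ?thesis .
  qed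
  then have W0: "poly W x = 0" for x
    using bij by (metis bij_betw_imp_surj_on imageE lessThan_iff UNIV_I)
  have "degree W \<le> degree U"
    unfolding W_def
    by (rule degree_sum_le) (auto intro!: order.trans[OF degree_smult_le] simp: degree_pcompose)
  then have "W = 0"
    using U(1) W0 by (intro poly_eq_0_if_vanishes) (auto simp: p_def)
  moreover have "coeff W (degree U) = lead_coeff U * poly (map_poly of_int q) 1"
  proof -
    have "coeff (U \<circ>\<^sub>p [:r, 1:]) (degree U) = lead_coeff U" for r
      using lead_coeff_comp[of "[:r, 1:]" U] by (simp add: degree_pcompose)
    then have "coeff W (degree U) = (\<Sum>r\<in>UNIV. of_int (c r) * lead_coeff U)"
      by (simp add: W_def coeff_sum)
    also have "\<dots> = lead_coeff U * (\<Sum>n\<le>degree q. of_int (coeff q n))"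
      by (simp add: sum_c sum_distrib_left mult_ac)
    also have "(\<Sum>n\<le>degree q. of_int (coeff q n) :: 'p mod_ring) = poly (map_poly of_int q) 1"
      unfolding poly_altdef
      by (intro sum.mono_neutral_cong_right) (auto simp: degree_map_poly_le intro: coeff_eq_0, metis coeff_eq_0 not_le of_int_hom.coeff_map_poly_hom)
    finally show ?thesis .
  qed
  ultimately show False using q1 Unz by simp
qed

end

section \<open>Binomial and Vandermonde systems, and minors of the Fourier matrix\<close>

text \<open>Clearing the denominator makes the binomial coefficient a monic polynomial of degree
  \<open>i\<close> in \<open>n\<close> over any commutative ring. For \<open>i > n\<close> the
  factor with \<open>t = n\<close> is zero, matching the left side.\<close>

lemma fact_mult_binomial:
  "(of_nat (fact i * (n choose i)) :: 'a::comm_ring_1) = (\<Prod>t<i. of_nat n - of_nat t)"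
proof (induction i)
  case (Suc i)
  have "fact (Suc i) * (n choose Suc i) = fact i * (n choose i) * (n - i)"
    using binomial_absorb_comp[of n i] binomial_absorption[of i n]
    by (metis (no_types, lifting) fact_Suc mult.assoc mult.commute of_nat_id)
  also have "(of_nat \<dots> :: 'a) = (\<Prod>t<i. of_nat n - of_nat t) * (of_nat n - of_nat i)"
  proof (cases "i \<le> n")
    case False
    then have "n choose i = 0" "n \<in> {..<i}" by auto
    then show ?thesis by (metis Suc.IH mult_eq_0_iff mult_zero_left of_nat_0)
  qed (simp only: of_nat_mult[of "fact i * (n choose i)"] Suc.IH of_nat_diff)
  finally show ?case by simp
qed simp

lemma of_nat_eq_mod_ring:
  assumes "m < CARD('p::prime_card)" "n < CARD('p)" "(of_nat m :: 'p mod_ring) = of_nat n"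
  shows "m = n"
  using assms bij_betw_of_nat_mod_ring[where 'p = 'p] by (auto simp: bij_betw_def inj_on_def)

lemma inj_on_of_nat_mod_ring:
  fixes b :: "nat \<Rightarrow> nat"
  assumes "inj_on b {..<m}" "\<And>j. j < m \<Longrightarrow> b j < CARD('p::prime_card)"
  shows "inj_on (\<lambda>j. of_nat (b j) :: 'p mod_ring) {..<m}"
proof (rule inj_onI)
  fix x y assume xy: "x \<in> {..<m}" "y \<in> {..<m}" and eq: "(of_nat (b x) :: 'p mod_ring) = of_nat (b y)"
  have "b x = b y" by (rule of_nat_eq_mod_ring[OF _ _ eq]) (use xy assms(2) in auto)
  then show "x = y" using xy assms(1) by (auto dest: inj_onD)
qed

lemma of_nat_fact_mod_ring:
  assumes "i < CARD('p::prime_card)"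
  shows "(of_nat (fact i) :: 'p mod_ring) \<noteq> 0"
proof
  assume "(of_nat (fact i) :: 'p mod_ring) = 0"
  then have "CARD('p) dvd fact i" by (rule of_nat_0_mod_ring_dvd)
  then show False using assms prime_dvd_fact_iff[OF prime_card[where 'a = 'p]] by simp
qed

text \<open>A nonzero kernel vector would be the coefficient list, in the Newton basis of binomial
  polynomials, of a nonzero polynomial of degree below \<open>m\<close> with the \<open>m\<close>
  distinct roots \<open>b j\<close>. The factorials involved are invertible since
  \<open>m \<le> CARD('p)\<close>.\<close>

lemma binomial_matrix_kernel:
  fixes b :: "nat \<Rightarrow> nat" and u :: "nat \<Rightarrow> 'p::prime_card mod_ring"
  assumes b: "inj_on b {..<m}" "\<And>j. j < m \<Longrightarrow> b j < CARD('p)"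
    and u: "\<And>j. j < m \<Longrightarrow> (\<Sum>i<m. of_nat (b j choose i) * u i) = 0"
  shows "\<forall>i<m. u i = 0"
proof (rule ccontr)
  assume nz: "\<not> (\<forall>i<m. u i = 0)"
  \<comment> \<open>The last nonzero entry will be the degree of that polynomial.\<close>
  define k where "k = (GREATEST i. i < m \<and> u i \<noteq> 0)"
  have k: "k < m \<and> u k \<noteq> 0"
    unfolding k_def by (rule GreatestI_ex_nat[of _ m]) (use nz in auto)
  have k': "u i = 0" if "k < i" "i < m" for i
    using Greatest_le_nat[of "\<lambda>i. i < m \<and> u i \<noteq> 0" i m] that unfolding k_def by auto
  have "m \<le> CARD('p)"
    using card_inj_on_le[OF b(1), of "{..<CARD('p)}"] b(2) by auto
  define F where "F i = (\<Prod>t<i. [:- of_nat t, 1:] :: 'p mod_ring poly)" for i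
  have degF: "degree (F i) = i" and monicF: "lead_coeff (F i) = 1" for i
    unfolding F_def by (subst degree_prod_eq_sum_degree, auto simp: lead_coeff_prod)
  define P where "P = (\<Sum>i\<le>k. smult (u i / of_nat (fact i)) (F i))"
  have root: "poly P (of_nat (b j)) = 0" if "j < m" for j
  proof -
    have "poly P (of_nat (b j)) = (\<Sum>i\<le>k. of_nat (b j choose i) * u i)"
      unfolding P_def poly_sum
    proof (intro sum.cong refl)
      fix i assume "i \<in> {..k}"
      then have "(of_nat (fact i) :: 'p mod_ring) \<noteq> 0"
        using k \<open>m \<le> CARD('p)\<close> by (intro of_nat_fact_mod_ring) simp
      moreover have "poly (F i) (of_nat (b j)) = of_nat (fact i * (b j choose i))"
        unfolding F_def fact_mult_binomial by (simp add: poly_prod)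
      ultimately show "poly (smult (u i / of_nat (fact i)) (F i)) (of_nat (b j))
          = of_nat (b j choose i) * u i"
        by simp
    qed
    also have "\<dots> = (\<Sum>i<m. of_nat (b j choose i) * u i)"
      using k k' by (intro sum.mono_neutral_left) auto
    finally show ?thesis using u[OF that] by simp
  qed
  have "coeff P k = (\<Sum>i\<le>k. if i = k then u i / of_nat (fact i) else 0)"
    unfolding P_def coeff_sum using monicF[of k] degF
    by (intro sum.cong refl) (auto simp: coeff_eq_0)
  then have "coeff P k \<noteq> 0"
    using k \<open>m \<le> CARD('p)\<close> of_nat_fact_mod_ring[where 'p = 'p, of k] by simp
  then have "P \<noteq> 0" by auto
  have inj: "inj_on (\<lambda>j. of_nat (b j) :: 'p mod_ring) {..<m}"
    using b by (rule inj_on_of_nat_mod_ring)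
  have "m = card ((\<lambda>j. of_nat (b j) :: 'p mod_ring) ` {..<m})" using card_image[OF inj] by simp
  also have "\<dots> \<le> card {x. poly P x = 0}"
    using root by (intro card_mono) auto
  also have "\<dots> \<le> degree P" using \<open>P \<noteq> 0\<close> by (rule card_poly_roots_bound)
  also have "\<dots> \<le> k" unfolding P_def
    by (rule degree_sum_le) (auto intro!: order.trans[OF degree_smult_le] simp: degF)
  finally show False using k by simp
qed

text \<open>Testing the system against the polynomial that vanishes at all nodes except
  \<open>a i\<close> isolates \<open>u i\<close>.\<close>

lemma vandermonde_kernel:
  fixes u :: "nat \<Rightarrow> 'a::idom"
  assumes a: "inj_on a {..<m}" and u: "\<And>l. l < m \<Longrightarrow> (\<Sum>i<m. a i ^ l * u i) = 0" and i: "i < m"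
  shows "u i = 0"
proof -
  define P where "P = (\<Prod>j\<in>{..<m} - {i}. [:- a j, 1:])"
  have "degree P < m"
    unfolding P_def using i by (subst degree_prod_eq_sum_degree) auto
  have "(\<Sum>i<m. poly P (a i) * u i) = (\<Sum>l\<le>degree P. coeff P l * (\<Sum>i<m. a i ^ l * u i))"
    unfolding poly_altdef sum_distrib_left sum_distrib_right
    by (subst sum.swap) (simp add: mult_ac)
  also have "\<dots> = 0" using u \<open>degree P < m\<close> by simp
  finally have "(\<Sum>j<m. poly P (a j) * u j) = 0" .
  moreover have "(\<Sum>j<m. poly P (a j) * u j) = (\<Sum>j\<in>{i}. poly P (a j) * u j)"
    using i by (intro sum.mono_neutral_right) (auto simp: P_def poly_prod intro!: prod_zero)
  moreover have "poly P (a i) \<noteq> 0"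
    using a i by (auto simp: P_def poly_prod inj_on_def)
  ultimately show ?thesis by simp
qed

text \<open>\<open>N\<close> is the adjugate of the integral binomial matrix and \<open>D\<close>
  its determinant, which survives reduction modulo \<open>p\<close> by
  \<open>binomial_matrix_kernel\<close>.\<close>

lemma binomial_left_inverse:
  fixes b :: "nat \<Rightarrow> nat"
  assumes b: "inj_on b {..<m}" "\<And>j. j < m \<Longrightarrow> b j < CARD('p::prime_card)"
  obtains N :: "nat \<Rightarrow> nat \<Rightarrow> int" and D :: int
  where "(of_int D :: 'p mod_ring) \<noteq> 0"
    "\<And>l i. l < m \<Longrightarrow> i < m \<Longrightarrow> (\<Sum>j<m. N l j * int (b j choose i)) = (if i = l then D else 0)"
proof -
  let ?M = "mat m m (\<lambda>(j, i). int (b j choose i))"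
  let ?h = "of_int :: int \<Rightarrow> 'p mod_ring"
  have M: "?M \<in> carrier_mat m m" and M': "map_mat ?h ?M \<in> carrier_mat m m" by auto
  have "det (map_mat ?h ?M) \<noteq> 0"
  proof
    assume "det (map_mat ?h ?M) = 0"
    then obtain w where w: "w \<in> carrier_vec m" "w \<noteq> 0\<^sub>v m" "map_mat ?h ?M *\<^sub>v w = 0\<^sub>v m"
      unfolding det_0_iff_vec_prod_zero_field[OF M'] by auto
    have "\<forall>i<m. w $ i = 0"
    proof (rule binomial_matrix_kernel[OF b])
      fix j assume j: "j < m"
      then have "(map_mat ?h ?M *\<^sub>v w) $ j = 0" using w by simp
      then show "(\<Sum>i<m. of_nat (b j choose i) * w $ i) = 0"
        using j w(1) by (auto simp: scalar_prod_def lessThan_atLeast0)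
    qed
    then show False using w(1,2) by (metis carrier_vecD eq_vecI index_zero_vec)
  qed
  then have "?h (det ?M) \<noteq> 0" by (simp add: of_int_hom.hom_det)
  moreover have "(\<Sum>j<m. adj_mat ?M $$ (l, j) * int (b j choose i)) = (if i = l then det ?M else 0)"
    if "l < m" "i < m" for l i
  proof -
    have "(adj_mat ?M * ?M) $$ (l, i) = (if i = l then det ?M else 0)"
      using that by (simp add: adj_mat(3)[OF M])
    then show ?thesis
      using that adj_mat(1)[OF M] by (simp add: scalar_prod_def lessThan_atLeast0)
  qed
  ultimately show thesis by (rule that)
qed

text \<open>
  In the expansion \<open>z^(ab) = (\<Sum>l. (b choose l) (z^a - 1)^l)\<close> an integral left inverse of the binomial
  matrix isolates each of the lowest powers. After division by powers of \<open>z - 1\<close> the system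
  becomes \<open>E\<close>, which reduces to a multiple of a Vandermonde system at \<open>z = 1\<close> modulo \<open>p\<close>.
\<close>

lemma chebotarev:
  fixes e :: "'p::prime_card mod_ring \<Rightarrow> complex" and a b :: "nat \<Rightarrow> nat"
  assumes e: "add_char e"
    and a: "inj_on a {..<m}" "\<And>j. j < m \<Longrightarrow> a j < CARD('p)"
    and b: "inj_on b {..<m}" "\<And>j. j < m \<Longrightarrow> b j < CARD('p)"
    and f: "\<And>j. j < m \<Longrightarrow> (\<Sum>i<m. f i * e 1 ^ (a i * b j)) = 0"
    and i: "i < m"
  shows "f i = 0"
proof (rule ccontr)
  assume fi: "f i \<noteq> 0"
  define p where "p = CARD('p)"
  define z where "z = e 1"
  have z1: "z - 1 \<noteq> 0" unfolding z_def using e_1[OF e] by simp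
  have "m \<le> p"
    using card_inj_on_le[OF b(1), of "{..<p}"] b(2) by (auto simp: p_def)
  obtain N D where D: "(of_int D :: 'p mod_ring) \<noteq> 0"
    and N: "\<And>l i. l < m \<Longrightarrow> i < m \<Longrightarrow> (\<Sum>j<m. N l j * int (b j choose i)) = (if i = l then D else 0)"
    using binomial_left_inverse[OF b] by metis
  \<comment> \<open>\<open>N\<close> times the binomial matrix with all columns
    \<open>l' < p\<close>: its first \<open>m\<close> columns are \<open>D\<close> times the
    identity, the others stay uncontrolled.\<close>
  define d where "d l l' = (\<Sum>j<m. N l j * int (b j choose l'))" for l l'
  \<comment> \<open>The quotient \<open>(X ^ a i - 1) / (X - 1)\<close>, whose value at
    \<open>1\<close> is \<open>a i\<close>.\<close>
  define g where "g i = (\<Sum>t<a i. monom 1 t :: int poly)" for i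
  define G where "G i = poly (map_poly of_int (g i)) z" for i
  \<comment> \<open>Row \<open>l\<close> of the transformed system after division by
    \<open>(z - 1) ^ l\<close>, with an indeterminate in place of \<open>z\<close> so that it can
    also be evaluated at \<open>1\<close> modulo \<open>p\<close>.\<close>
  define E where "E l i = [:D:] * g i ^ l
      + (\<Sum>l'\<in>{m..<p}. [:d l l':] * [:-1, 1:] ^ (l' - l) * g i ^ l')" for l i
  interpret \<phi>: comm_ring_hom "\<lambda>q :: int poly. poly (map_poly of_int q) z"
    by unfold_locales (auto simp: of_int_poly_hom.hom_add of_int_poly_hom.hom_mult)
  have g1: "(z - 1) * poly (map_poly of_int (g i)) z = z ^ a i - 1" for i
    by (simp add: g_def \<phi>.hom_sum of_int_hom.map_poly_hom_monom
        poly_monom power_diff_1_eq)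
  interpret \<psi>: comm_ring_hom "\<lambda>q :: int poly. poly (map_poly of_int q) (1 :: 'p mod_ring)"
    by unfold_locales (auto simp: of_int_poly_hom.hom_add of_int_poly_hom.hom_mult)
  have const: "poly (map_poly of_int [:c:]) x = of_int c" for c :: int and x :: "'k::comm_ring_1"
    by (cases "c = 0") (simp_all add: map_poly_pCons)
  have \<phi>E: "poly (map_poly of_int (E l i)) z
      = of_int D * G i ^ l + (\<Sum>l'\<in>{m..<p}. of_int (d l l') * (z - 1) ^ (l' - l) * G i ^ l')" for l i
    unfolding E_def \<phi>.hom_add \<phi>.hom_sum \<phi>.hom_mult \<phi>.hom_power const by (simp add: G_def)
  \<comment> \<open>The uncontrolled columns have \<open>l' \<ge> m > l\<close>, so each carries a
    positive power of \<open>X - 1\<close> and vanishes at \<open>1\<close>.\<close>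
  have \<psi>E: "poly (map_poly of_int (E l i)) (1 :: 'p mod_ring) = of_int D * of_nat (a i) ^ l"
    if "l < m" for l i
  proof -
    have "poly (map_poly of_int (g i)) (1 :: 'p mod_ring) = of_nat (a i)"
      by (simp add: g_def poly_sum poly_monom)
    then show ?thesis
      using that unfolding E_def \<psi>.hom_add \<psi>.hom_sum \<psi>.hom_mult \<psi>.hom_power const
      by (auto intro!: sum.neutral)
  qed
  have row: "(\<Sum>i<m. poly (map_poly of_int (E l i)) z * f i) = 0" if l: "l < m" for l
  proof -
    have pow: "z ^ (a i * b j) = (\<Sum>l'<p. of_nat (b j choose l') * ((z - 1) * G i) ^ l')"
      if "j < m" for i j
    proof -
      have "z ^ (a i * b j) = (((z - 1) * G i) + 1) ^ b j"
        unfolding G_def g1 by (simp add: power_mult)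
      also have "\<dots> = (\<Sum>l'\<le>b j. of_nat (b j choose l') * ((z - 1) * G i) ^ l')"
        by (simp add: binomial_ring)
      also have "\<dots> = (\<Sum>l'<p. of_nat (b j choose l') * ((z - 1) * G i) ^ l')"
        using b(2)[OF that] by (intro sum.mono_neutral_left) (auto simp: p_def)
      finally show ?thesis .
    qed
    have "0 = (\<Sum>j<m. of_int (N l j) * (\<Sum>i<m. f i * z ^ (a i * b j)))"
      using f by (simp add: z_def)
    also have "\<dots> = (\<Sum>j<m. of_int (N l j) *
        (\<Sum>i<m. f i * (\<Sum>l'<p. of_nat (b j choose l') * ((z - 1) * G i) ^ l')))"
      using pow by simp
    also have "\<dots> = (\<Sum>i<m. f i * (\<Sum>l'<p. of_int (d l l') * ((z - 1) * G i) ^ l'))"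
    proof -
      have "(\<Sum>j<m. of_int (N l j) *
          (\<Sum>i<m. f i * (\<Sum>l'<p. of_nat (b j choose l') * ((z - 1) * G i) ^ l')))
        = (\<Sum>i<m. \<Sum>j<m. \<Sum>l'<p. of_int (N l j) * (f i * (of_nat (b j choose l') * ((z - 1) * G i) ^ l')))"
        unfolding sum_distrib_left by (rule sum.swap)
      also have "\<dots> = (\<Sum>i<m. \<Sum>l'<p. \<Sum>j<m. of_int (N l j) * (f i * (of_nat (b j choose l') * ((z - 1) * G i) ^ l')))"
        by (intro sum.cong refl sum.swap)
      also have "\<dots> = (\<Sum>i<m. f i * (\<Sum>l'<p. of_int (d l l') * ((z - 1) * G i) ^ l'))"
        unfolding sum_distrib_left d_def of_int_sum sum_distrib_right
        by (intro sum.cong refl) (simp add: mult_ac)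
      finally show ?thesis .
    qed
    also have "\<dots> = (\<Sum>i<m. f i * ((z - 1) ^ l * poly (map_poly of_int (E l i)) z))"
    proof (intro sum.cong refl arg_cong2[where f = "(*)"])
      fix i
      have "{..<p} = {..<m} \<union> {m..<p}" using \<open>m \<le> p\<close> by auto
      then have "(\<Sum>l'<p. of_int (d l l') * ((z - 1) * G i) ^ l')
          = (\<Sum>l'<m. of_int (d l l') * ((z - 1) * G i) ^ l')
          + (\<Sum>l'\<in>{m..<p}. of_int (d l l') * ((z - 1) * G i) ^ l')"
        by (simp add: sum.union_disjoint ivl_disj_int)
      also have "(\<Sum>l'<m. of_int (d l l') * ((z - 1) * G i) ^ l')
          = (\<Sum>l'<m. if l' = l then of_int D * ((z - 1) * G i) ^ l' else 0)"
        using N l by (intro sum.cong refl) (auto simp: d_def)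
      also have "\<dots> = (z - 1) ^ l * (of_int D * G i ^ l)"
        using l by (simp add: power_mult_distrib)
      also have "(\<Sum>l'\<in>{m..<p}. of_int (d l l') * ((z - 1) * G i) ^ l')
          = (z - 1) ^ l * (\<Sum>l'\<in>{m..<p}. of_int (d l l') * (z - 1) ^ (l' - l) * G i ^ l')"
        unfolding sum_distrib_left
      proof (intro sum.cong refl)
        fix l' assume "l' \<in> {m..<p}"
        then have "(z - 1) ^ l' = (z - 1) ^ l * (z - 1) ^ (l' - l)"
          using l by (simp flip: power_add)
        then show "of_int (d l l') * ((z - 1) * G i) ^ l'
            = (z - 1) ^ l * (of_int (d l l') * (z - 1) ^ (l' - l) * G i ^ l')"
          by (simp add: power_mult_distrib)
      qed
      finally show "(\<Sum>l'<p. of_int (d l l') * ((z - 1) * G i) ^ l')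
          = (z - 1) ^ l * poly (map_poly of_int (E l i)) z"
        unfolding \<phi>E by (simp add: distrib_left)
    qed
    also have "\<dots> = (z - 1) ^ l * (\<Sum>i<m. poly (map_poly of_int (E l i)) z * f i)"
      by (simp add: sum_distrib_left mult_ac)
    finally show ?thesis using z1 by simp
  qed
  have ker: "poly (map_poly of_int q) (1 :: 'p mod_ring) = 0" if "poly (map_poly of_int q) z = 0" for q
    using cyclotomic_mod_p[OF e] that unfolding z_def by blast
  from kernel_transfer[where M = E and v = f, OF \<phi>.comm_ring_hom_axioms \<psi>.comm_ring_hom_axioms ker row i fi]
  obtain u where u: "\<And>l. l < m \<Longrightarrow> (\<Sum>i<m. poly (map_poly of_int (E l i)) 1 * u i) = 0"
    and u0: "\<exists>i<m. u i \<noteq> (0 :: 'p mod_ring)"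
    by blast
  have "u i = 0" if "i < m" for i
  proof (rule vandermonde_kernel[OF _ _ that])
    show "inj_on (\<lambda>j. of_nat (a j) :: 'p mod_ring) {..<m}"
      using a by (rule inj_on_of_nat_mod_ring)
    fix l assume l: "l < m"
    have "of_int D * (\<Sum>i<m. of_nat (a i) ^ l * u i) = 0"
      using u[OF l] unfolding \<psi>E[OF l] by (simp add: sum_distrib_left mult.assoc)
    then show "(\<Sum>i<m. of_nat (a i) ^ l * u i) = 0" using D by simp
  qed
  then show False using u0 by blast
qed

text \<open>If the bound failed, the transform would have at least as many zeros as \<open>f\<close>
  has support points. Equally many of these zeros select a square submatrix of the Fourier matrix
  that kills the nonzero values of \<open>f\<close>, against \<open>chebotarev\<close>.\<close>

theorem uncertainty_prime:
  fixes e :: "'p::prime_card mod_ring \<Rightarrow> complex"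
  assumes e: "add_char e" and f: "f x0 \<noteq> 0"
  shows "card {x. f x \<noteq> 0} + card {y. (\<Sum>x\<in>UNIV. f x * e (x * y)) \<noteq> 0} \<ge> CARD('p) + 1"
proof (rule ccontr)
  assume less: "\<not> ?thesis"
  define m where "m = card {x. f x \<noteq> 0}"
  define Z where "Z = {y. (\<Sum>x\<in>UNIV. f x * e (x * y)) = 0}"
  obtain rep where rep: "\<And>x :: 'p mod_ring. rep x < CARD('p) \<and> of_nat (rep x) = x"
    using surj_of_nat_mod_ring by metis
  have "card Z = CARD('p) - card {y. (\<Sum>x\<in>UNIV. f x * e (x * y)) \<noteq> 0}"
    unfolding Z_def using card_Diff_subset[of "{y. (\<Sum>x\<in>UNIV. f x * e (x * y)) \<noteq> 0}" UNIV]
    by (simp add: Collect_neg_eq[symmetric] Compl_eq_Diff_UNIV[symmetric])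
  then have "m \<le> card Z" using less unfolding m_def by linarith
  then obtain B where B: "B \<subseteq> Z" "card B = m" "finite B"
    by (metis obtain_subset_with_card_n)
  obtain \<alpha> where \<alpha>: "bij_betw \<alpha> {..<m} {x. f x \<noteq> 0}"
    using ex_bij_betw_nat_finite[of "{x. f x \<noteq> 0}"] by (auto simp: m_def lessThan_atLeast0)
  obtain \<beta> where \<beta>: "bij_betw \<beta> {..<m} B"
    using ex_bij_betw_nat_finite[OF B(3)] B(2) by (auto simp: lessThan_atLeast0)
  have inj: "inj_on (\<lambda>i. rep (h i)) {..<m}" if "inj_on h {..<m}" for h
    using that rep by (metis (mono_tags, lifting) inj_on_def)
  obtain i where i: "i < m" "\<alpha> i = x0"
    using \<alpha> f by (auto simp: bij_betw_def image_iff) (metis (mono_tags, lifting) image_iff lessThan_iff mem_Collect_eq)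
  have "f (\<alpha> i) = 0"
  proof (rule chebotarev[OF e, where a = "\<lambda>i. rep (\<alpha> i)" and b = "\<lambda>i. rep (\<beta> i)" and f = "\<lambda>i. f (\<alpha> i)"])
    fix j assume "j < m"
    then have "\<beta> j \<in> Z" using \<beta> B(1) by (auto simp: bij_betw_def)
    then have "0 = (\<Sum>x\<in>UNIV. f x * e (x * \<beta> j))" by (simp add: Z_def)
    also have "\<dots> = (\<Sum>x | f x \<noteq> 0. f x * e (x * \<beta> j))"
      by (rule sum.mono_neutral_right) auto
    also have "\<dots> = (\<Sum>i<m. f (\<alpha> i) * e (\<alpha> i * \<beta> j))"
      by (rule sum.reindex_bij_betw[OF \<alpha>, symmetric])
    also have "\<dots> = (\<Sum>i<m. f (\<alpha> i) * e 1 ^ (rep (\<alpha> i) * rep (\<beta> j)))"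
      using rep by (simp flip: e_of_nat[OF e])
    finally show "(\<Sum>i<m. f (\<alpha> i) * e 1 ^ (rep (\<alpha> i) * rep (\<beta> j))) = 0" by simp
  qed (use i rep inj \<alpha> \<beta> in \<open>auto simp: bij_betw_def\<close>)
  then show False using i f by simp
qed

section \<open>Point sets missing few lines\<close>

definition dot :: "'a::comm_ring_1 \<times> 'a \<Rightarrow> 'a \<times> 'a \<Rightarrow> 'a" where
  "dot x y = fst x * fst y + snd x * snd y"

text \<open>In the bivariate product of the
  \<open>\<alpha> i + \<beta> i * x + \<gamma> i * v\<close>, \<open>q n\<close> is the coefficient
  of \<open>v ^ n\<close> as a polynomial in \<open>x\<close>. The total degree is at most
  \<open>card I\<close>, and the part of that degree is the product of the
  \<open>\<beta> i * x + \<gamma> i * v\<close>, written here with \<open>v = 1\<close>.\<close>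

lemma linear_product_coeffs:
  fixes \<alpha> \<beta> \<gamma> :: "'i \<Rightarrow> 'a::idom"
  assumes "finite I"
  shows "\<exists>q. (\<forall>n k. n + k > card I \<longrightarrow> coeff (q n) k = 0) \<and>
    (\<forall>n k. n + k = card I \<longrightarrow> coeff (q n) k = coeff (\<Prod>i\<in>I. [:\<gamma> i, \<beta> i:]) k) \<and>
    (\<forall>n x. coeff (\<Prod>i\<in>I. [:\<alpha> i + \<beta> i * x, \<gamma> i:]) n = poly (q n) x)"
proof -
  \<comment> \<open>The added fourth conjunct serves the induction: for \<open>n = 0\<close> the
    contribution of \<open>\<gamma> i\<close> to the top coefficient has to vanish.\<close>
  have "\<exists>q. (\<forall>n k. n + k > card I \<longrightarrow> coeff (q n) k = 0) \<and>
    (\<forall>n k. n + k = card I \<longrightarrow> coeff (q n) k = coeff (\<Prod>i\<in>I. [:\<gamma> i, \<beta> i:]) k) \<and>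
    (\<forall>n x. coeff (\<Prod>i\<in>I. [:\<alpha> i + \<beta> i * x, \<gamma> i:]) n = poly (q n) x) \<and>
    (\<forall>k > card I. coeff (\<Prod>i\<in>I. [:\<gamma> i, \<beta> i:]) k = 0)"
    using assms
  proof induction
    case empty
    show ?case
      by (rule exI[of _ "\<lambda>n. if n = 0 then 1 else 0"]) (auto simp: coeff_1)
  next
    case (insert i I)
    obtain q where q: "\<And>n k. n + k > card I \<Longrightarrow> coeff (q n) k = 0"
      "\<And>n k. n + k = card I \<Longrightarrow> coeff (q n) k = coeff (\<Prod>i\<in>I. [:\<gamma> i, \<beta> i:]) k"
      "\<And>n x. coeff (\<Prod>i\<in>I. [:\<alpha> i + \<beta> i * x, \<gamma> i:]) n = poly (q n) x"
      "\<And>k. k > card I \<Longrightarrow> coeff (\<Prod>i\<in>I. [:\<gamma> i, \<beta> i:]) k = 0"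
      using insert.IH by (elim exE conjE) (rule that; simp)
    have lin: "coeff ([:a, c:] * P) n = a * coeff P n + (case n of 0 \<Rightarrow> 0 | Suc m \<Rightarrow> c * coeff P m)"
      for a c :: 'a and P n
      by (simp add: coeff_pCons split: nat.split)
    define q' where "q' n = [:\<alpha> i, \<beta> i:] * q n + (case n of 0 \<Rightarrow> 0 | Suc m \<Rightarrow> smult (\<gamma> i) (q m))" for n
    show ?case
    proof (intro exI[of _ q'] conjI allI impI)
      fix n k assume "n + k > card (insert i I)"
      then show "coeff (q' n) k = 0"
        using insert.hyps q(1) by (auto simp: q'_def lin simp del: mult_pCons_left split: nat.split)
    next
      fix n k assume "n + k = card (insert i I)"
      then show "coeff (q' n) k = coeff (\<Prod>i\<in>insert i I. [:\<gamma> i, \<beta> i:]) k"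
        using insert.hyps q(1,2,4)
        by (auto simp: q'_def lin simp del: mult_pCons_left split: nat.split)
    next
      fix n x
      show "coeff (\<Prod>i\<in>insert i I. [:\<alpha> i + \<beta> i * x, \<gamma> i:]) n = poly (q' n) x"
        using insert.hyps q(3)
        by (auto simp: q'_def lin algebra_simps simp del: mult_pCons_left split: nat.split)
    next
      fix k assume "k > card (insert i I)"
      then show "coeff (\<Prod>i\<in>insert i I. [:\<gamma> i, \<beta> i:]) k = 0"
        using insert.hyps q(4) by (auto simp: lin simp del: mult_pCons_left split: nat.split)
    qed
  qed
  then show ?thesis by (elim exE conjE) (intro exI conjI)
qed

text \<open>Move one point \<open>t0\<close> of \<open>T\<close> to the origin. Each
  \<open>(u, v) \<noteq> 0\<close> defines a line avoiding \<open>t0\<close>, so another point of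
  \<open>T\<close> lies on it and kills the product \<open>F\<close>, while \<open>F\<close> is
  \<open>1\<close> at the origin. Thus the sum of \<open>F\<close> over the plane is
  \<open>1\<close>; but a total degree below \<open>2 * (CARD('p) - 1)\<close> leaves no monomial
  with both exponents \<open>CARD('p) - 1\<close>, which makes the sum zero.\<close>

lemma affine_blocking_set:
  fixes T :: "('p::prime_card mod_ring \<times> 'p mod_ring) set"
  assumes T: "\<And>w c. w \<noteq> 0 \<Longrightarrow> \<exists>t\<in>T. dot t w = c"
  shows "card T + 1 \<ge> 2 * CARD('p)"
proof (rule ccontr)
  assume less: "\<not> ?thesis"
  obtain t0 where t0: "t0 \<in> T" using T[of "(1, 0)" 0] by (auto simp: zero_prod_def)
  define I where "I = T - {t0}"
  have "card T > 0" using t0 by (auto simp: card_gt_0_iff)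
  then have N: "card I < 2 * (CARD('p) - 1)"
    using less t0 by (simp add: I_def)
  define \<beta> where "\<beta> t = fst t0 - fst t" for t :: "'p mod_ring \<times> 'p mod_ring"
  define \<gamma> where "\<gamma> t = snd t0 - snd t" for t :: "'p mod_ring \<times> 'p mod_ring"
  define F where "F u = (\<Prod>t\<in>I. [:1 + \<beta> t * u, \<gamma> t:])" for u
  obtain q where q0: "(\<forall>n k. n + k > card I \<longrightarrow> coeff (q n) k = 0) \<and>
    (\<forall>n k. n + k = card I \<longrightarrow> coeff (q n) k = coeff (\<Prod>t\<in>I. [:\<gamma> t, \<beta> t:]) k) \<and>
    (\<forall>n x. coeff (\<Prod>t\<in>I. [:1 + \<beta> t * x, \<gamma> t:]) n = poly (q n) x)"
    using linear_product_coeffs[OF finite[of I], of \<gamma> \<beta> "\<lambda>_. 1"] by (rule exE)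
  have q: "\<And>n k. n + k > card I \<Longrightarrow> coeff (q n) k = 0" "\<And>n x. coeff (F x) n = poly (q n) x"
    using q0 by (simp_all add: F_def)
  have dF: "degree (F u) < 2 * (CARD('p) - 1)" for u
  proof -
    have "degree (F u) \<le> card I"
    proof (rule degree_le, intro allI impI)
      fix n assume "n > card I"
      then have "q n = 0" using q(1) by (intro poly_eqI) simp
      then show "coeff (F u) n = 0" using q(2) by simp
    qed
    then show ?thesis using N by simp
  qed
  have F: "poly (F u) v = (if u = 0 \<and> v = 0 then 1 else 0)" for u v
  proof (cases "u = 0 \<and> v = 0")
    case False
    then have "(u, v) \<noteq> 0" by (auto simp: zero_prod_def)
    from T[OF this, of "1 + dot t0 (u, v)"]
    obtain t where t: "t \<in> T" "dot t (u, v) = 1 + dot t0 (u, v)" by blast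
    then have "t \<in> I" "1 + \<beta> t * u + v * \<gamma> t = 0"
      by (auto simp: I_def dot_def \<beta>_def \<gamma>_def algebra_simps)
    then show ?thesis using False by (auto simp: F_def poly_prod intro!: prod_zero)
  qed (simp add: F_def poly_prod)
  have "(\<Sum>u\<in>UNIV. \<Sum>v\<in>UNIV. poly (F u) v) = (\<Sum>u\<in>UNIV. if u = (0 :: 'p mod_ring) then 1 else 0)"
    by (intro sum.cong refl) (auto simp: F)
  then have "(\<Sum>u\<in>UNIV. \<Sum>v\<in>UNIV. poly (F u) v) = 1" by simp
  moreover have "(\<Sum>v\<in>UNIV. poly (F u) v) = - poly (q (CARD('p) - 1)) u" for u
    using sum_poly_power[of "F u" 0] dF[of u] q(2)[of u "CARD('p) - 1"] by simp
  moreover have "(\<Sum>u\<in>UNIV. poly (q (CARD('p) - 1)) u) = 0"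
  proof -
    have "degree (q (CARD('p) - 1)) \<le> card I"
      by (intro degree_le allI impI q(1)) (use card_mod_ring_gt_1[where 'p = 'p] in simp)
    then show ?thesis
      using sum_poly_power[of "q (CARD('p) - 1)" 0] q(1)[of "CARD('p) - 1" "CARD('p) - 1"] N by simp
  qed
  ultimately show False by (simp add: sum_negf)
qed

text \<open>
  \<open>r'\<close> and \<open>c'\<close> are the values of \<open>r\<close> and \<open>c\<close> at the point at infinity of the \<open>y\<close>-line (the vertical
  direction), where a polynomial of formal degree \<open>n\<close> takes its coefficient at \<open>n\<close> as value.
\<close>

lemma missed_line_moments:
  fixes S :: "('p::prime_card mod_ring \<times> 'p mod_ring) set"
  assumes card: "card S = CARD('p) - 1 + k"
    and c: "\<And>x y. x \<noteq> c y \<Longrightarrow> \<exists>(a, b)\<in>S. x = b - a * y"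
    and c': "\<And>x. x \<noteq> c' \<Longrightarrow> \<exists>(a, b)\<in>S. x = - a"
  shows "\<exists>A r r'.
    (\<forall>j. k + j < CARD('p) - 1 \<longrightarrow> degree (A j) \<le> k + j \<and> coeff (A j) (k + j) = r' * c' ^ j) \<and>
    (\<forall>j y. poly (A j) y = r y * c y ^ j) \<and>
    (\<forall>y. r y = 0 \<longrightarrow> (\<exists>(a, b)\<in>S. c y = b - a * y))"
proof -
  \<comment> \<open>The Redei product for fixed \<open>x\<close>, as a polynomial in the slope
    \<open>y\<close>. Its top homogeneous part \<open>\<Prod>(x + a * y)\<close> at
    \<open>y = 1\<close> gives \<open>R\<close>, whose roots record the vertical lines meeting
    \<open>S\<close>.\<close>
  define G where "G x = (\<Prod>t\<in>S. [:- snd t + 1 * x, fst t:])" for x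
  define R where "R = (\<Prod>t\<in>S. [:fst t, 1:])"
  obtain q where q0: "(\<forall>n k. n + k > card S \<longrightarrow> coeff (q n) k = 0) \<and>
    (\<forall>n k. n + k = card S \<longrightarrow> coeff (q n) k = coeff (\<Prod>t\<in>S. [:fst t, 1:]) k) \<and>
    (\<forall>n x. coeff (\<Prod>t\<in>S. [:- snd t + 1 * x, fst t:]) n = poly (q n) x)"
    using linear_product_coeffs[OF finite[of S], of fst "\<lambda>_. 1" "\<lambda>t. - snd t"] by (rule exE)
  have q: "\<And>n i. n + i > card S \<Longrightarrow> coeff (q n) i = 0"
       "\<And>n i. n + i = card S \<Longrightarrow> coeff (q n) i = coeff R i"
       "\<And>n x. coeff (G x) n = poly (q n) x"
    using q0 by (simp_all add: G_def R_def)
  \<comment> \<open>At a given \<open>y\<close> only \<open>x = c y\<close> can contribute, as every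
    other line of that slope meets \<open>S\<close>; hence the geometric progression in
    \<open>j\<close>.\<close>
  define A where "A j = - (\<Sum>x\<in>UNIV. smult (x ^ j) (G x))" for j
  define r where "r y = - poly (G (c y)) y" for y
  define r' where "r' = - poly R c'"
  have polyG: "poly (G x) y = (\<Prod>t\<in>S. x - (snd t - fst t * y))" for x y
    unfolding G_def by (simp add: poly_prod algebra_simps)
  have polyR: "poly R x = (\<Prod>t\<in>S. x - - fst t)" for x
    unfolding R_def by (simp add: poly_prod algebra_simps)
  have A: "poly (A j) y = r y * c y ^ j" for j y
  proof -
    have "poly (A j) y = - (\<Sum>x\<in>UNIV. x ^ j * poly (G x) y)" by (simp add: A_def poly_sum)
    also have "(\<Sum>x\<in>UNIV. x ^ j * poly (G x) y) = (\<Sum>x\<in>{c y}. x ^ j * poly (G x) y)"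
    proof (rule sum.mono_neutral_right)
      show "\<forall>x\<in>UNIV - {c y}. x ^ j * poly (G x) y = 0"
      proof
        fix x assume "x \<in> UNIV - {c y}"
        then obtain a b where "(a, b) \<in> S" "x = b - a * y" using c by blast
        then show "x ^ j * poly (G x) y = 0"
          unfolding polyG by (intro mult_eq_0_iff[THEN iffD2] disjI2 prod_zero bexI[of _ "(a, b)"]) auto
      qed
    qed auto
    finally show ?thesis by (simp add: r_def)
  qed
  have r: "\<exists>(a, b)\<in>S. c y = b - a * y" if "r y = 0" for y
    using that unfolding r_def polyG by auto
  \<comment> \<open>The power sum turns this into the coefficient of \<open>q n\<close> at
    \<open>CARD('p) - 1 - j\<close>. The total degree bound kills it for \<open>n > k + j\<close>;
    for \<open>n = k + j\<close> it is a coefficient of \<open>R\<close>, and the power sum for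
    \<open>R\<close>, concentrated at \<open>c'\<close>, evaluates it.\<close>
  have coeffA: "coeff (A j) n = (if n = k + j then r' * c' ^ j else 0)"
    if j: "k + j < CARD('p) - 1" and n: "n \<ge> k + j" for j n
  proof (cases "n \<le> card S")
    case False
    then have "q n = 0" using q(1) by (intro poly_eqI) simp
    then show ?thesis using j False card by (simp add: A_def coeff_sum q(3))
  next
    case True
    have "degree (q n) \<le> card S - n" by (rule degree_le) (use q(1) in auto)
    then have "coeff (A j) n = coeff (q n) (CARD('p) - 1 - j)"
      using sum_poly_power[of "q n" j] j n card True
      by (simp add: A_def coeff_sum q(3) mult.commute)
    moreover have "coeff (q n) (CARD('p) - 1 - j) = 0" if "n \<noteq> k + j"
      using that n j card by (intro q(1)) simp
    moreover have "coeff (q n) (CARD('p) - 1 - j) = r' * c' ^ j" if "n = k + j"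
    proof -
      have "coeff (q n) (CARD('p) - 1 - j) = coeff R (CARD('p) - 1 - j)"
        using that j card by (intro q(2)) simp
      also have "\<dots> = - (\<Sum>x\<in>UNIV. poly R x * x ^ j)"
      proof -
        have "degree R \<le> card S" unfolding R_def
          by (rule order.trans[OF degree_prod_sum_le]) auto
        then show ?thesis using sum_poly_power[of R j] j card by simp
      qed
      also have "(\<Sum>x\<in>UNIV. poly R x * x ^ j) = (\<Sum>x\<in>{c'}. poly R x * x ^ j)"
      proof (rule sum.mono_neutral_right)
        show "\<forall>x\<in>UNIV - {c'}. poly R x * x ^ j = 0"
        proof
          fix x assume "x \<in> UNIV - {c'}"
          then obtain a b where "(a, b) \<in> S" "x = - a" using c' by blast
          then show "poly R x * x ^ j = 0"
            unfolding polyR by (intro mult_eq_0_iff[THEN iffD2] disjI1 prod_zero bexI[of _ "(a, b)"]) auto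
        qed
      qed auto
      finally show ?thesis by (simp add: r'_def)
    qed
    ultimately show ?thesis by auto
  qed
  show ?thesis
  proof (rule exI[of _ A], rule exI[of _ r], rule exI[of _ r'], intro conjI allI impI)
    show "degree (A j) \<le> k + j" if "k + j < CARD('p) - 1" for j
      by (rule degree_le) (use coeffA[OF that] in auto)
    show "coeff (A j) (k + j) = r' * c' ^ j" if "k + j < CARD('p) - 1" for j
      using coeffA[OF that] by simp
  qed (use A r in auto)
qed

section \<open>Polynomial identities checked on the projective line\<close>

text \<open>Values at infinity multiply; \<open>m\<close> and \<open>n\<close> are formal degrees,
  so the coefficients there may be zero.\<close>

lemma coeff_mult_top:
  fixes P Q :: "'a::comm_semiring_1 poly"
  assumes "degree P \<le> m" "degree Q \<le> n"
  shows "coeff (P * Q) (m + n) = coeff P m * coeff Q n"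
proof -
  have "coeff (P * Q) (m + n) = (\<Sum>i\<le>m + n. coeff P i * coeff Q (m + n - i))"
    by (rule coeff_mult)
  also have "\<dots> = (\<Sum>i\<in>{m}. coeff P i * coeff Q (m + n - i))"
  proof (rule sum.mono_neutral_right)
    show "\<forall>i\<in>{..m + n} - {m}. coeff P i * coeff Q (m + n - i) = 0"
    proof
      fix i assume i: "i \<in> {..m + n} - {m}"
      show "coeff P i * coeff Q (m + n - i) = 0"
      proof (cases "i < m")
        case True
        then have "coeff Q (m + n - i) = 0" using assms by (intro coeff_eq_0) simp
        then show ?thesis by simp
      next
        case False
        then have "coeff P i = 0" using i assms by (intro coeff_eq_0) auto
        then show ?thesis by simp
      qed
    qed
  qed auto
  finally show ?thesis by simp
qed

lemma coeff_power_top: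
  fixes P :: "'a::comm_semiring_1 poly"
  assumes "degree P \<le> m"
  shows "degree (P ^ j) \<le> j * m \<and> coeff (P ^ j) (j * m) = coeff P m ^ j"
proof (induction j)
  case (Suc j)
  then show ?case
    using coeff_mult_top[OF assms, of "P ^ j" "j * m"] degree_mult_le[of P "P ^ j"] assms by simp
qed simp

text \<open>The point at infinity supplies one more value than the field has elements, which admits
  formal degree \<open>CARD('p)\<close> itself.\<close>

lemma poly_eqI_projective:
  fixes P Q :: "'p::prime_card mod_ring poly"
  assumes "degree P \<le> n" "degree Q \<le> n" "n \<le> CARD('p)" "coeff P n = coeff Q n"
    and "\<And>x. poly P x = poly Q x"
  shows "P = Q"
proof -
  have "degree (P - Q) \<le> n" using assms by (intro degree_diff_le)
  have "P - Q = 0"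
  proof (rule ccontr)
    assume "P - Q \<noteq> 0"
    then have "coeff (P - Q) (degree (P - Q)) \<noteq> 0" by (rule leading_coeff_neq_0)
    then have "degree (P - Q) \<noteq> n" using assms(4) by auto
    then have "degree (P - Q) < CARD('p)" using \<open>degree (P - Q) \<le> n\<close> assms(3) by simp
    then have "P - Q = 0" by (rule poly_eq_0_if_vanishes) (use assms in simp)
    then show False using \<open>P - Q \<noteq> 0\<close> by simp
  qed
  then show ?thesis by simp
qed

text \<open>A pointwise relation, used both at field elements and at infinity. If
  \<open>A0 \<noteq> 0\<close>, then \<open>g\<close> can be cancelled and \<open>b = a * c\<close>.
  If \<open>A0 = 0\<close>, then \<open>a\<close> or \<open>h\<close> is zero, and the outer factor
  \<open>a\<close> makes both sides vanish.\<close>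

lemma geometric_values:
  fixes a b :: "'a::field"
  assumes "A0 = a ^ j * h" "A0 = a * g" "A0 * c = b * g"
  shows "a * (a * (A0 * c ^ Suc j)) = a * (b ^ Suc j * h)"
proof (cases "A0 = 0")
  case True
  then have "a = 0 \<or> h = 0" using assms(1) by auto
  then show ?thesis using True by auto
next
  case False
  then have "g \<noteq> 0" using assms(2) by auto
  moreover have "(a * c) * g = b * g" using assms(2,3) by (simp add: algebra_simps)
  ultimately have "b = a * c" by simp
  then show ?thesis using assms(1) by (simp add: power_mult_distrib algebra_simps)
qed

text \<open>
  Writing \<open>A 1 / A 0 = b / a\<close> in lowest terms, the degree bounds turn the pointwise relations into
  identities \<open>A j = A 0 (b / a)^j\<close>, so \<open>a^j\<close> divides \<open>A 0\<close> for \<open>j\<close> beyond its degree. Equality of the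
  values at infinity covers the borderline case of degree \<open>p\<close>.
\<close>

lemma geometric_polys_ratio_linear:
  fixes A :: "nat \<Rightarrow> 'p::prime_card mod_ring poly"
  assumes k: "2 * k + 3 \<le> CARD('p)"
    and deg: "\<And>j. j \<le> k + 1 \<Longrightarrow> degree (A j) \<le> k + j"
    and top: "\<And>j. j \<le> k + 1 \<Longrightarrow> coeff (A j) (k + j) = r' * c' ^ j"
    and val: "\<And>j y. poly (A j) y = r y * c y ^ j"
  shows "\<exists>u v. A 1 = [:u, v:] * A 0"
proof (cases "A 0 = 0")
  case True
  then have "r y = 0" for y using val[of 0 y] by simp
  then have "A 1 = 0"
    using val[of 1] deg[of 1] k by (intro poly_eq_0_if_vanishes) auto
  then show ?thesis using True by simp
next
  case A0: False
  define g where "g = gcd (A 0) (A 1)"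
  have "g \<noteq> 0" using A0 by (simp add: g_def)
  then obtain a b where ab: "A 0 = a * g" "A 1 = b * g" "coprime a b"
    using gcd_coprime_exists[of "A 0" "A 1"] unfolding g_def by blast
  have "a \<noteq> 0" using A0 ab(1) by auto
  \<comment> \<open>The least formal degree of \<open>a\<close> that allows \<open>b\<close> formal
    degree \<open>D + 1\<close>. The goal is \<open>D = 0\<close>: then \<open>a\<close> is constant
    and \<open>b\<close> has degree at most one.\<close>
  define D where "D = max (degree a) (degree b - 1)"
  have aD: "degree a \<le> D" and bD: "degree b \<le> D + 1" by (auto simp: D_def)
  have hdeg: "degree h + j * D \<le> k" if h: "A 0 = a ^ j * h" "A j = b ^ j * h" and j: "j \<le> k + 1" for h j
  proof -
    have "h \<noteq> 0" using h(1) A0 by auto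
    have "degree (A 0) = j * degree a + degree h"
      unfolding h(1) using \<open>a \<noteq> 0\<close> \<open>h \<noteq> 0\<close> by (simp add: degree_mult_eq degree_power_eq)
    then have 1: "j * degree a + degree h \<le> k" using deg[of 0] by simp
    have 2: "j * (degree b - 1) + degree h \<le> k" if "degree b > 0"
    proof -
      have "b \<noteq> 0" using that by auto
      have "degree (A j) = j * degree b + degree h"
        unfolding h(2) using \<open>b \<noteq> 0\<close> \<open>h \<noteq> 0\<close> by (simp add: degree_mult_eq degree_power_eq)
      moreover have "j * degree b = j * (degree b - 1) + j" using that by (cases "degree b") auto
      ultimately show ?thesis using deg[OF j] by simp
    qed
    show ?thesis using 1 2 by (cases "degree b > 0") (auto simp: D_def max_def add.commute)
  qed
  have gD: "degree g + D \<le> k" using hdeg[of 1 g] ab by simp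
  \<comment> \<open>By coprimality each round of the induction extracts one more factor
    \<open>a\<close> from \<open>h\<close>.\<close>
  have absorb: "\<exists>h'. h = a * h' \<and> A j = b ^ j * h'" if "a * A j = b ^ j * h" for h j
  proof -
    have "a dvd b ^ j * h" using that by (metis dvd_triv_left)
    then have "a dvd h" using ab(3) by (simp add: coprime_dvd_mult_right_iff)
    then obtain h' where h': "h = a * h'" by (elim dvdE)
    then have "a * A j = a * (b ^ j * h')" using that by (simp add: mult_ac)
    then show ?thesis using h' \<open>a \<noteq> 0\<close> by auto
  qed
  \<comment> \<open>The factorisations of \<open>A 0\<close> and \<open>A 1\<close> read at
    infinity, with formal degrees \<open>D\<close>, \<open>D + 1\<close> and
    \<open>k - D\<close>.\<close>
  have gr: "a' * g' = r'" "b' * g' = r' * c'"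
    if "a' = coeff a D" "b' = coeff b (D + 1)" "g' = coeff g (k - D)" for a' b' g'
  proof -
    have gk: "degree g \<le> k - D" using gD by simp
    show "a' * g' = r'"
      using coeff_mult_top[OF aD gk] top[of 0] gD that ab(1) by simp
    show "b' * g' = r' * c'"
      using coeff_mult_top[OF bD gk] top[of 1] gD that ab(2) by simp
  qed
  have "D = 0"
  proof (rule ccontr)
    assume "D \<noteq> 0"
    then have "1 \<le> k" using gD by simp
    have "\<exists>h. A 0 = a ^ j * h \<and> A j = b ^ j * h" if "1 \<le> j" "j \<le> k + 1" for j
      using that
    proof (induction j rule: dec_induct)
      case base
      show ?case using ab by (intro exI[of _ g]) simp
    next
      case (step j)
      then obtain h where h: "A 0 = a ^ j * h" "A j = b ^ j * h" by auto
      have hD: "degree h + j * D \<le> k" using hdeg[OF h] step by simp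
      have "a * A (Suc j) = b ^ Suc j * h"
      proof (cases "j = 1")
        case True
        \<comment> \<open>The bound on \<open>n\<close> in the general step uses
          \<open>j \<ge> 2\<close>. For \<open>j = 1\<close> this identity of formal degree
          \<open>2 * k + 2\<close> replaces it.\<close>
        have "A 1 * A 1 = A 0 * A 2"
        proof (rule poly_eqI_projective[where n = "(k + 1) + (k + 1)"])
          show "degree (A 1 * A 1) \<le> (k + 1) + (k + 1)"
            using deg[of 1] by (intro order.trans[OF degree_mult_le] add_mono) auto
          show "degree (A 0 * A 2) \<le> (k + 1) + (k + 1)"
            using deg[of 0] deg[of 2] \<open>1 \<le> k\<close> by (intro order.trans[OF degree_mult_le]) auto
          show "coeff (A 1 * A 1) ((k + 1) + (k + 1)) = coeff (A 0 * A 2) ((k + 1) + (k + 1))"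
            using coeff_mult_top[of "A 1" "k + 1" "A 1" "k + 1"] coeff_mult_top[of "A 0" k "A 2" "k + 2"]
              deg[of 0] deg[of 1] deg[of 2] top[of 0] top[of 1] top[of 2] \<open>1 \<le> k\<close>
            by (simp add: power2_eq_square mult_ac)
        qed (use k in \<open>auto simp: val power2_eq_square\<close>)
        then have "b * g * (b * g) = a * g * A 2" unfolding ab(1,2) .
        then have "g * (a * A 2) = g * (b ^ 2 * g)" by (simp only: power2_eq_square mult_ac)
        then have "a * A 2 = b ^ 2 * g" using \<open>g \<noteq> 0\<close> by simp
        moreover have "h = g" using h(1) ab(1) \<open>a \<noteq> 0\<close> True by simp
        ultimately show ?thesis using True by (simp add: numeral_2_eq_2)
      next
        case False
        \<comment> \<open>From \<open>j * D \<le> k\<close> with \<open>j \<ge> 2\<close> and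
          \<open>D \<ge> 1\<close> one gets \<open>2 * D + j \<le> k + 2\<close>, hence
          \<open>n \<le> 2 * k + 3\<close>, at most the field size.\<close>
        define n where "n = D + (D + (k + Suc j))"
        have "n \<le> CARD('p)"
        proof -
          obtain d where d: "D = Suc d" using \<open>D \<noteq> 0\<close> by (cases D) auto
          obtain i where i: "j = i + 2" using False step by (metis add.commute le_Suc_ex Suc_1 Suc_leI le_neq_implies_less)
          have "j * D = i * d + i + 2 * d + 2" by (simp add: d i algebra_simps)
          then have "i + 2 * d + 2 \<le> k" using hD by linarith
          then show ?thesis using k by (simp add: n_def d i)
        qed
        have hk: "degree h \<le> k - j * D" using hD by simp
        have n2: "n = D + (Suc j * (D + 1) + (k - j * D))" using hD by (simp add: n_def algebra_simps)
        have jk: "Suc j \<le> k + 1" using step by simp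
        have bj: "degree (b ^ Suc j) \<le> Suc j * (D + 1)"
          "coeff (b ^ Suc j) (Suc j * (D + 1)) = coeff b (D + 1) ^ Suc j"
          using coeff_power_top[OF bD, of "Suc j"] by auto
        have d1: "degree (a * A (Suc j)) \<le> D + (k + Suc j)"
          using deg[OF jk] aD by (intro order.trans[OF degree_mult_le] add_mono) auto
        have d2: "degree (b ^ Suc j * h) \<le> Suc j * (D + 1) + (k - j * D)"
          using bj(1) hk by (intro order.trans[OF degree_mult_le] add_mono) auto
        have "a * (a * A (Suc j)) = a * (b ^ Suc j * h)"
        proof (rule poly_eqI_projective[where n = n])
          show "degree (a * (a * A (Suc j))) \<le> n"
            unfolding n_def by (rule order.trans[OF degree_mult_le add_mono[OF aD d1]])
          show "degree (a * (b ^ Suc j * h)) \<le> n"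
            unfolding n2 by (rule order.trans[OF degree_mult_le add_mono[OF aD d2]])
          have l: "coeff (a * (a * A (Suc j))) n = coeff a D * (coeff a D * (r' * c' ^ Suc j))"
            unfolding n_def coeff_mult_top[OF aD d1] coeff_mult_top[OF aD deg[OF jk]] top[OF jk] ..
          have rr: "coeff (a * (b ^ Suc j * h)) n
              = coeff a D * (coeff b (D + 1) ^ Suc j * coeff h (k - j * D))"
            unfolding n2 coeff_mult_top[OF aD d2] coeff_mult_top[OF bj(1) hk] bj(2) ..
          have "r' = coeff a D ^ j * coeff h (k - j * D)"
            using coeff_mult_top[of "a ^ j" "j * D" h "k - j * D"] coeff_power_top[OF aD, of j]
              hk hD top[of 0] h(1) by simp
          then show "coeff (a * (a * A (Suc j))) n = coeff (a * (b ^ Suc j * h)) n"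
            unfolding l rr
            by (rule geometric_values) (use gr[OF refl refl refl] in auto)
          show "poly (a * (a * A (Suc j))) x = poly (a * (b ^ Suc j * h)) x" for x
          proof -
            have "poly a x * (poly a x * (r x * c x ^ Suc j)) = poly a x * (poly b x ^ Suc j * poly h x)"
            proof (rule geometric_values)
              show "r x = poly a x ^ j * poly h x" using val[of 0 x] h(1) by simp
              show "r x = poly a x * poly g x" using val[of 0 x] ab(1) by simp
              show "r x * c x = poly b x * poly g x" using val[of 1 x] ab(2) by simp
            qed
            then show ?thesis by (simp add: val)
          qed
        qed (rule \<open>n \<le> CARD('p)\<close>)
        then show ?thesis using \<open>a \<noteq> 0\<close> by simp
      qed
      from absorb[OF this] obtain h' where "h = a * h'" "A (Suc j) = b ^ Suc j * h'" by blast
      then show ?case using h(1) by (intro exI[of _ h']) (simp add: mult_ac)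
    qed
    \<comment> \<open>One power more than the degree bound \<open>k\<close> of \<open>A 0\<close>
      has room for.\<close>
    from this[of "k + 1"] obtain h where h: "A 0 = a ^ (k + 1) * h" "A (k + 1) = b ^ (k + 1) * h"
      by auto
    have "(k + 1) * D \<le> k" using hdeg[OF h] by simp
    then show False using \<open>D \<noteq> 0\<close> by (cases D) auto
  qed
  then have "degree a = 0" "degree b \<le> 1" using aD bD by auto
  then obtain a0 b0 b1 where "a = [:a0:]" "b = [:b0, b1:]"
    by (metis One_nat_def degree_eq_zeroE degree1_coeffs le_Suc_eq le_zero_eq pCons_0_0)
  moreover from this have "a0 \<noteq> 0" using \<open>a \<noteq> 0\<close> by auto
  ultimately have "A 1 = [:b0 / a0, b1 / a0:] * A 0"
    using ab(1,2) by (simp add: smult_add_right)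
  then show ?thesis by blast
qed

lemma direction_missing_two_lines:
  fixes S :: "('p::prime_card mod_ring \<times> 'p mod_ring) set"
  assumes p: "CARD('p) \<ge> 3" and S: "2 * card S < 3 * (CARD('p) - 1)"
  shows "\<exists>w. w \<noteq> 0 \<and> card ((\<lambda>x. dot x w) ` S) + 2 \<le> CARD('p)"
proof (rule ccontr)
  assume neg: "\<not> ?thesis"
  have big: "card ((\<lambda>x. dot x w) ` S) + 1 \<ge> CARD('p)" if "w \<noteq> 0" for w
  proof -
    have "\<not> card ((\<lambda>x. dot x w) ` S) + 2 \<le> CARD('p)" using neg that by blast
    then show ?thesis by linarith
  qed
  have miss: "\<exists>c. \<forall>x. x \<noteq> c \<longrightarrow> (\<exists>t\<in>S. dot t w = x)" if "w \<noteq> 0" for w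
  proof -
    have "card (- (\<lambda>x. dot x w) ` S) \<le> 1"
      using big[OF that] by (simp add: Compl_eq_Diff_UNIV card_Diff_subset)
    then have "\<forall>a\<in>- (\<lambda>x. dot x w) ` S. \<forall>b\<in>- (\<lambda>x. dot x w) ` S. a = b"
      by (subst (asm) One_nat_def, subst (asm) card_le_Suc0_iff_eq) auto
    then obtain c where "- (\<lambda>x. dot x w) ` S \<subseteq> {c}" by blast
    then have "x \<in> (\<lambda>x. dot x w) ` S" if "x \<noteq> c" for x using that by blast
    then show ?thesis by (intro exI[of _ c]) (auto simp: image_iff)
  qed
  \<comment> \<open>The lines \<open>x = b - a * y\<close> of slope \<open>y\<close> are the level
    sets of \<open>dot\<close> with \<open>(- y, 1)\<close>, the vertical ones those with
    \<open>(- 1, 0)\<close>.\<close>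
  have "\<forall>y. \<exists>c. \<forall>x. x \<noteq> c \<longrightarrow> (\<exists>t\<in>S. dot t (- y, 1) = x)"
    using miss by (auto simp: zero_prod_def)
  then obtain c where c: "\<And>x y. x \<noteq> c y \<Longrightarrow> \<exists>t\<in>S. dot t (- y, 1) = x" by metis
  obtain c' where c': "\<And>x. x \<noteq> c' \<Longrightarrow> \<exists>t\<in>S. dot t (- 1, 0) = x"
    using miss[of "(- 1, 0)"] by (auto simp: zero_prod_def)
  have "card S + 1 \<ge> CARD('p)"
    using big[of "(1, 0)"] card_image_le[of S "\<lambda>x. dot x (1, 0)"] by (simp add: zero_prod_def)
  define k where "k = card S - (CARD('p) - 1)"
  have card: "card S = CARD('p) - 1 + k" using \<open>card S + 1 \<ge> CARD('p)\<close> by (simp add: k_def)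
  have "odd CARD('p)" using prime_odd_nat[OF prime_card[where 'a = 'p]] p by simp
  \<comment> \<open>The size of \<open>S\<close> gives \<open>2 * k < CARD('p) - 1\<close>; parity
    improves this by one.\<close>
  then have k: "2 * k + 3 \<le> CARD('p)" using S card p by presburger
  have c1: "\<exists>(a, b)\<in>S. x = b - a * y" if "x \<noteq> c y" for x y
    using c[OF that] by (force simp: dot_def)
  have c2: "\<exists>(a, b)\<in>S. x = - a" if "x \<noteq> c'" for x
    using c'[OF that] by (force simp: dot_def)
  have "\<exists>A r r'.
    (\<forall>j. k + j < CARD('p) - 1 \<longrightarrow> degree (A j) \<le> k + j \<and> coeff (A j) (k + j) = r' * c' ^ j) \<and>
    (\<forall>j y. poly (A j) y = r y * c y ^ j) \<and>
    (\<forall>y. r y = 0 \<longrightarrow> (\<exists>(a, b)\<in>S. c y = b - a * y))"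
    by (rule missed_line_moments[OF card c1 c2])
  then obtain A r r' where A:
    "(\<forall>j. k + j < CARD('p) - 1 \<longrightarrow> degree (A j) \<le> k + j \<and> coeff (A j) (k + j) = r' * c' ^ j) \<and>
    (\<forall>j y. poly (A j) y = r y * c y ^ j) \<and>
    (\<forall>y. r y = 0 \<longrightarrow> (\<exists>(a, b)\<in>S. c y = b - a * y))"
    by (elim exE) (rule that)
  then have A3: "poly (A j) y = r y * c y ^ j" for j y by simp
  have A4: "\<exists>(a, b)\<in>S. c y = b - a * y" if "r y = 0" for y using A that by simp
  have A1: "degree (A j) \<le> k + j" and A2: "coeff (A j) (k + j) = r' * c' ^ j" if "j \<le> k + 1" for j
    using that k A by auto
  have "\<exists>u v. A 1 = [:u, v:] * A 0"
    by (rule geometric_polys_ratio_linear[OF k A1 A2 A3])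
  then obtain u v where uv: "A 1 = [:u, v:] * A 0" by blast
  have cy: "c y = u + v * y" if "r y \<noteq> 0" for y
  proof -
    have "c y * r y = (u + v * y) * r y"
      using A3[of 1 y] A3[of 0 y] unfolding uv by (simp add: algebra_simps)
    then show ?thesis by (rule mult_right_cancel[OF that, THEN iffD1])
  qed
  \<comment> \<open>The first point lies on every line \<open>c y = u + v * y\<close>, the second on
    the possibly missed vertical line. Where \<open>r y = 0\<close>, the line given by
    \<open>c y\<close> already meets \<open>S\<close>.\<close>
  define T where "T = S \<union> {(- v, u), (- c', 0)}"
  have "\<exists>t\<in>T. dot t w = z" if "w \<noteq> 0" for w z
  proof (cases "snd w = 0")
    case True
    then have "fst w \<noteq> 0" using that by (auto simp: zero_prod_def prod_eq_iff)
    have eq: "dot t w = - fst w * dot t (- 1, 0)" for t using True by (simp add: dot_def)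
    have "\<exists>t\<in>T. dot t (- 1, 0) = - z / fst w"
    proof (cases "- z / fst w = c'")
      case True
      then show ?thesis by (intro bexI[of _ "(- c', 0)"]) (auto simp: T_def dot_def)
    qed (use c' in \<open>auto simp: T_def\<close>)
    then obtain t where "t \<in> T" "dot t (- 1, 0) = - z / fst w" by blast
    then show ?thesis using \<open>fst w \<noteq> 0\<close> by (intro bexI[of _ t]) (simp_all add: eq)
  next
    case False
    define y where "y = - fst w / snd w"
    have eq: "dot t w = snd w * dot t (- y, 1)" for t
      using False by (simp add: dot_def y_def algebra_simps)
    have "\<exists>t\<in>T. dot t (- y, 1) = z / snd w"
    proof (cases "z / snd w = c y")
      case True
      show ?thesis
      proof (cases "r y = 0")
        case True
        then obtain a b where "(a, b) \<in> S" "c y = b - a * y" using A4 by blast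
        then show ?thesis using \<open>z / snd w = c y\<close>
          by (intro bexI[of _ "(a, b)"]) (auto simp: T_def dot_def)
      next
        case False
        then show ?thesis using \<open>z / snd w = c y\<close> cy
          by (intro bexI[of _ "(- v, u)"]) (auto simp: T_def dot_def)
      qed
    qed (use c in \<open>auto simp: T_def\<close>)
    then obtain t where "t \<in> T" "dot t (- y, 1) = z / snd w" by blast
    then show ?thesis using False by (intro bexI[of _ t]) (simp_all add: eq)
  qed
  then have "card T + 1 \<ge> 2 * CARD('p)" by (rule affine_blocking_set)
  moreover have "card T \<le> card S + 2"
    unfolding T_def by (rule order.trans[OF card_Un_le]) (simp add: card_insert_if)
  \<comment> \<open>Here \<open>2 * CARD('p) - 3 \<le> card S\<close> and
    \<open>card S < 3 / 2 * (CARD('p) - 1)\<close> together would force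
    \<open>CARD('p) < 3\<close>.\<close>
  ultimately show False using S p by linarith
qed

section \<open>Supports in the plane\<close>

text \<open>A quarter turn. Over a field and for \<open>w \<noteq> 0\<close>, \<open>rot w\<close>
  spans the line \<open>dot x w = 0\<close>, whose annihilator under \<open>dot\<close> is the line
  \<open>dot y (rot w) = 0\<close>.\<close>

definition rot :: "'a::comm_ring_1 \<times> 'a \<Rightarrow> 'a \<times> 'a" where
  "rot w = (- snd w, fst w)"

lemma rot_eq_0_iff [simp]: "rot w = 0 \<longleftrightarrow> w = 0"
  by (cases w) (auto simp: rot_def zero_prod_def)

lemma rot_rot [simp]: "rot (rot w) = - w"
  by (cases w) (simp add: rot_def)

lemma dot_rot [simp]: "dot (rot w) w = 0"
  by (simp add: rot_def dot_def)

lemma dot_add_left: "dot (x + y) w = dot x w + dot y w"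
  by (simp add: dot_def algebra_simps)

lemma dot_diff_left: "dot (x - y) w = dot x w - dot y w"
  by (simp add: dot_def algebra_simps)

lemma dot_uminus_right [simp]: "dot x (- w) = - dot x w"
  by (simp add: dot_def algebra_simps)

lemma dot_commute: "dot x y = dot y x"
  by (simp add: dot_def algebra_simps)

definition scale :: "'a::comm_ring_1 \<Rightarrow> 'a \<times> 'a \<Rightarrow> 'a \<times> 'a" where
  "scale t w = (t * fst w, t * snd w)"

lemma dot_scale_left: "dot (scale t x) y = t * dot x y"
  by (simp add: dot_def scale_def algebra_simps)

lemma inj_scale:
  fixes w :: "'a::field \<times> 'a"
  assumes "w \<noteq> 0"
  shows "inj (\<lambda>t. x + scale t w)"
  using assms by (cases w) (auto simp: inj_on_def scale_def zero_prod_def)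

lemma dot_eq_0_iff_scale_rot:
  fixes w :: "'a::field \<times> 'a"
  assumes "w \<noteq> 0"
  shows "dot x w = 0 \<longleftrightarrow> (\<exists>t. x = scale t (rot w))"
proof
  assume "dot x w = 0"
  then have eq: "fst x * fst w = - (snd x * snd w)" by (simp add: dot_def eq_neg_iff_add_eq_0)
  show "\<exists>t. x = scale t (rot w)"
  proof (cases "fst w = 0")
    case True
    then have "snd w \<noteq> 0" using assms by (simp add: prod_eq_iff)
    then have "snd x = 0" using eq True by simp
    then have "x = scale (- fst x / snd w) (rot w)"
      using True \<open>snd w \<noteq> 0\<close> by (simp add: prod_eq_iff scale_def rot_def)
    then show ?thesis ..
  next
    case False
    then have "fst x = - (snd x * snd w) / fst w"
      using eq by (simp only: nonzero_eq_divide_eq[OF False])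
    then have "x = scale (snd x / fst w) (rot w)"
      using False by (simp add: prod_eq_iff scale_def rot_def)
    then show ?thesis ..
  qed
qed (auto simp: dot_scale_left)

lemma line_eq_range:
  fixes w :: "'a::field \<times> 'a"
  assumes "w \<noteq> 0"
  shows "{x. dot x w = dot x0 w} = range (\<lambda>t. x0 + scale t (rot w))"
proof -
  have "dot x w = dot x0 w \<longleftrightarrow> (\<exists>t. x = x0 + scale t (rot w))" for x
    using dot_eq_0_iff_scale_rot[OF assms, of "x - x0"]
    by (simp add: dot_diff_left diff_eq_eq add.commute)
  then show ?thesis by auto
qed

lemma card_line:
  fixes w :: "'p::prime_card mod_ring \<times> 'p mod_ring"
  assumes "w \<noteq> 0"
  shows "card {x. dot x w = dot x0 w} = CARD('p)"
  unfolding line_eq_range[OF assms] using assms by (subst card_image) (auto intro: inj_scale)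

text \<open>The second cardinality counts the lines of the orthogonal direction that meet
  \<open>X\<close>.\<close>

definition line_bound :: "('p::prime_card mod_ring \<times> 'p mod_ring) set \<Rightarrow> ('p mod_ring \<times> 'p mod_ring) set \<Rightarrow> bool" where
  "line_bound S X \<longleftrightarrow> (\<forall>w x0. w \<noteq> 0 \<longrightarrow> x0 \<in> S \<longrightarrow>
     card {x \<in> S. dot x w = dot x0 w} + card ((\<lambda>y. dot y (rot w)) ` X) \<ge> CARD('p) + 1)"

lemma line_boundD:
  fixes S :: "('p::prime_card mod_ring \<times> 'p mod_ring) set"
  assumes "line_bound S X" "w \<noteq> 0" "x0 \<in> S"
  shows "card {x \<in> S. dot x w = dot x0 w} + card ((\<lambda>y. dot y (rot w)) ` X) \<ge> CARD('p) + 1"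
  using assms unfolding line_bound_def by blast

text \<open>Along the line through \<open>x0\<close> with direction \<open>rot w\<close>,
  \<open>f\<close> becomes a one-dimensional transform of \<open>\<phi>\<close>, which sums
  \<open>g\<close> with weights over each orthogonal line. Since \<open>f x0 \<noteq> 0\<close>,
  \<open>\<phi>\<close> is not zero and \<open>uncertainty_prime\<close> applies to it.\<close>

lemma line_bound_transform:
  fixes f g :: "'p::prime_card mod_ring \<times> 'p mod_ring \<Rightarrow> complex"
  assumes e: "add_char e" and f: "\<And>x. f x = (\<Sum>y\<in>UNIV. g y * e (dot x y))"
  shows "line_bound {x. f x \<noteq> 0} {y. g y \<noteq> 0}"
  unfolding line_bound_def
proof (intro allI impI)
  fix w x0 :: "'p mod_ring \<times> 'p mod_ring"
  assume w: "w \<noteq> 0" and x0: "x0 \<in> {x. f x \<noteq> 0}"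
  define \<phi> where "\<phi> z = (\<Sum>y | dot y (rot w) = z. g y * e (dot x0 y))" for z
  have split: "e (dot (x0 + scale t (rot w)) y) = e (dot x0 y) * e (dot y (rot w) * t)" for t y
    by (simp add: dot_add_left dot_scale_left dot_commute[of y] e_add[OF e] mult.commute[of t])
  have f\<phi>: "f (x0 + scale t (rot w)) = (\<Sum>z\<in>UNIV. \<phi> z * e (z * t))" for t
  proof -
    have "(\<Sum>z\<in>UNIV. \<phi> z * e (z * t))
        = (\<Sum>z\<in>UNIV. \<Sum>y | y \<in> UNIV \<and> dot y (rot w) = z. g y * e (dot (x0 + scale t (rot w)) y))"
      unfolding \<phi>_def sum_distrib_right
      by (intro sum.cong refl) (auto simp: split)
    also have "\<dots> = (\<Sum>y\<in>UNIV. g y * e (dot (x0 + scale t (rot w)) y))"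
      by (rule sum.group) auto
    finally show ?thesis by (simp add: f)
  qed
  have "\<exists>z. \<phi> z \<noteq> 0"
  proof (rule ccontr)
    assume "\<nexists>z. \<phi> z \<noteq> 0"
    then have "f (x0 + scale 0 (rot w)) = 0" unfolding f\<phi> by simp
    then show False using x0 by (simp add: scale_def zero_prod_def[symmetric])
  qed
  then obtain z0 where "\<phi> z0 \<noteq> 0" by blast
  from uncertainty_prime[where f = \<phi>, OF e this]
  have "CARD('p) + 1 \<le> card {z. \<phi> z \<noteq> 0} + card {t. f (x0 + scale t (rot w)) \<noteq> 0}"
    by (simp add: f\<phi>)
  moreover have "card {z. \<phi> z \<noteq> 0} \<le> card ((\<lambda>y. dot y (rot w)) ` {y. g y \<noteq> 0})"
  proof (rule card_mono)
    show "{z. \<phi> z \<noteq> 0} \<subseteq> (\<lambda>y. dot y (rot w)) ` {y. g y \<noteq> 0}"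
    proof
      fix z assume "z \<in> {z. \<phi> z \<noteq> 0}"
      then obtain y where "dot y (rot w) = z" "g y * e (dot x0 y) \<noteq> 0"
        unfolding \<phi>_def by (auto elim: sum.not_neutral_contains_not_neutral)
      then show "z \<in> (\<lambda>y. dot y (rot w)) ` {y. g y \<noteq> 0}" by auto
    qed
  qed simp
  moreover have "card {t. f (x0 + scale t (rot w)) \<noteq> 0} \<le> card {x \<in> {x. f x \<noteq> 0}. dot x w = dot x0 w}"
  proof (rule card_inj_on_le)
    show "inj_on (\<lambda>t. x0 + scale t (rot w)) {t. f (x0 + scale t (rot w)) \<noteq> 0}"
      using inj_scale[of "rot w" x0] w by (auto intro: inj_on_subset)
    show "(\<lambda>t. x0 + scale t (rot w)) ` {t. f (x0 + scale t (rot w)) \<noteq> 0}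
        \<subseteq> {x \<in> {x. f x \<noteq> 0}. dot x w = dot x0 w}"
      by (auto simp: dot_add_left dot_scale_left)
  qed simp
  ultimately show "card {x \<in> {x. f x \<noteq> 0}. dot x w = dot x0 w}
      + card ((\<lambda>y. dot y (rot w)) ` {y. g y \<noteq> 0}) \<ge> CARD('p) + 1"
    by linarith
qed

lemma card_projection_uminus:
  "card ((\<lambda>x. dot x (- w)) ` S) = card ((\<lambda>x. dot x w) ` S)"
proof -
  have "(\<lambda>x. dot x (- w)) ` S = uminus ` (\<lambda>x. dot x w) ` S" by (simp add: image_image)
  then show ?thesis by (simp add: card_image inj_on_def)
qed

section \<open>Counting along parallel lines and the numerical inequalities\<close>

lemma card_ge_fibers:
  assumes "finite X" and "\<And>y. y \<in> X \<Longrightarrow> card {x \<in> X. h x = h y} \<ge> m"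
  shows "card X \<ge> card (h ` X) * m"
proof -
  have "card X = (\<Sum>z\<in>h ` X. card {x \<in> X. h x = z})"
    using sum.image_gen[OF assms(1), of "\<lambda>_. 1::nat" h] by simp
  also have "\<dots> \<ge> (\<Sum>z\<in>h ` X. m)" using assms(2) by (intro sum_mono) auto
  finally show ?thesis by simp
qed

text \<open>Equality holds at \<open>N = 3\<close>, \<open>s = p - 2\<close>. Each further full line
  gains \<open>p / 3\<close> and lowers the first term by at most \<open>1 / (p - 2)\<close>, which
  is no larger.\<close>

lemma bound_full_lines:
  fixes s N p :: nat
  assumes "p \<ge> 3" "N \<ge> 3" "s + N \<ge> p + 1"
  shows "1 / (real p - 2) * real s + 1 / 3 * (real N * real p) \<ge> real p + 1"
proof -
  have "(real N - 3) * (3 / (real p - 2)) \<le> (real N - 3) * real p"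
    using assms by (intro mult_left_mono) (auto simp: divide_le_eq intro: order.trans[OF _ mult_mono[of 3 _ 1]])
  moreover have "real s / (real p - 2) \<ge> (real p + 1 - real N) / (real p - 2)"
    using assms by (intro divide_right_mono) auto
  moreover have "(real p + 1 - real N) / (real p - 2) = 1 - (real N - 3) * (1 / (real p - 2))"
    using assms by (simp add: field_simps)
  moreover have "(real N - 3) * (3 / (real p - 2)) = 3 * ((real N - 3) * (1 / (real p - 2)))"
    "(real N - 3) * real p = real N * real p - 3 * real p"
    "1 / (real p - 2) * real s = real s / (real p - 2)"
    by (simp_all add: algebra_simps)
  ultimately show ?thesis by linarith
qed

text \<open>For the case of a line with exactly one point of \<open>S\<close>: then all
  \<open>p\<close> orthogonal lines meet the other support. The estimate is
  \<open>bound_full_lines\<close> with \<open>N = p + 1 - m\<close>.\<close>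

lemma bound_tangent:
  fixes s m p x :: nat
  assumes "p \<ge> 3" "m + 2 \<le> p" "m \<le> s" "x \<ge> p * (p + 1 - m)"
  shows "1 / (real p - 2) * real s + 1 / 3 * real x \<ge> real p + 1"
proof -
  have "1 / (real p - 2) * real s + 1 / 3 * (real (p + 1 - m) * real p) \<ge> real p + 1"
    using assms by (intro bound_full_lines) auto
  moreover have "real (p + 1 - m) * real p \<le> real x"
    using assms(4) by (metis mult.commute of_nat_le_iff of_nat_mult)
  ultimately show ?thesis by simp
qed

text \<open>From \<open>(m - 2) * (\<mu> - 2) \<ge> 0\<close> the product bounding \<open>x\<close>
  is at least \<open>(p - 1) * (p + 1 - s / 2)\<close>, its value for \<open>m = 2\<close> and
  \<open>\<mu> = s / 2\<close>. With \<open>2 * s + 5 \<le> 3 * p\<close> this suffices without the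
  first term when \<open>p \<ge> 7\<close>; only \<open>p = 5\<close> remains, since
  \<open>s \<ge> 4\<close>.\<close>

lemma bound_no_tangent:
  fixes s m \<mu> p x :: nat
  assumes "p \<ge> 3" "odd p" "2 \<le> m" "2 \<le> \<mu>" "m * \<mu> \<le> s" "2 * s < 3 * (p - 1)"
    and x: "real x \<ge> (real p + 1 - real \<mu>) * (real p + 1 - real m)"
  shows "1 / (real p - 2) * real s + 1 / 3 * real x \<ge> real p + 1"
proof -
  have "2 * 2 \<le> m * \<mu>" using assms by (intro mult_mono) auto
  then have s4: "4 \<le> s" using assms by simp
  have s2: "2 * s + 5 \<le> 3 * p" using assms(1,2,6) by presburger
  have "0 \<le> (real m - 2) * (real \<mu> - 2)" using assms by simp
  then have sum: "2 * (real m + real \<mu>) \<le> real m * real \<mu> + 4" by (simp add: algebra_simps)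
  have ms: "real m * real \<mu> \<le> real s" using assms(5) by (metis of_nat_le_iff of_nat_mult)
  have "2 * ((real p - 1) * (real p + 1 - real s / 2))
      \<le> 2 * ((real p - 1) * (real p + 1 - real m * real \<mu> / 2))"
    using ms assms(1) by (intro mult_left_mono) auto
  also have "\<dots> = 2 * (real p + 1)^2 - (real p + 1) * (real m * real \<mu> + 4) + 2 * (real m * real \<mu>)"
    by (simp add: field_simps power2_eq_square)
  also have "\<dots> \<le> 2 * (real p + 1)^2 - (real p + 1) * (2 * (real m + real \<mu>)) + 2 * (real m * real \<mu>)"
    using sum by (simp add: mult_left_mono)
  also have "\<dots> = 2 * ((real p + 1 - real \<mu>) * (real p + 1 - real m))"
    by (simp add: algebra_simps power2_eq_square)
  finally have xs: "real x \<ge> (real p - 1) * (real p + 1 - real s / 2)" using x by linarith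
  consider "p = 5" | "p \<ge> 7"
  proof -
    have "p \<noteq> 3" "p \<noteq> 4" "p \<noteq> 6" using s2 s4 assms(2) by auto
    then show thesis using that assms(1) by linarith
  qed
  then show ?thesis
  proof cases
    case 1
    then have "real s \<le> 5" using s2 by simp
    moreover have "real x \<ge> 4 * (6 - real s / 2)" using xs 1 by simp
    ultimately show ?thesis using 1 s4 by simp
  next
    case 2
    have "real (2 * s + 5) \<le> real (3 * p)" using s2 by (simp only: of_nat_le_iff)
    then have "real s / 2 \<le> (3 * real p - 5) / 4" by simp
    then have "(real p - 1) * ((real p + 9) / 4) \<le> (real p - 1) * (real p + 1 - real s / 2)"
      using 2 by (intro mult_left_mono) auto
    then have "real x \<ge> (real p - 1) * ((real p + 9) / 4)" using xs by linarith
    moreover have "0 \<le> (real p - 7) * (real p + 3)" using 2 by simp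
    ultimately have "1 / 3 * real x \<ge> real p + 1" by (simp add: algebra_simps)
    moreover have "1 / (real p - 2) * real s \<ge> 0" using 2 by simp
    ultimately show ?thesis using add_mono by fastforce
  qed
qed

text \<open>Stated for two point sets with the line bound both ways, so that it serves whichever
  support is the smaller. The main distinction is whether \<open>S\<close> lies on one line.\<close>

lemma small_support_dichotomy:
  fixes S X :: "('p::prime_card mod_ring \<times> 'p mod_ring) set"
  assumes p: "CARD('p) \<ge> 3" and ne: "S \<noteq> {}" "X \<noteq> {}"
    and SX: "line_bound S X" and XS: "line_bound X S"
    and small: "2 * card S < 3 * (CARD('p) - 1)"
  shows "1 / (real CARD('p) - 2) * real (card S) + 1 / 3 * real (card X) \<ge> real CARD('p) + 1 \<or>
    (\<exists>w c Z. w \<noteq> 0 \<and> S \<subseteq> {x. dot x w = c} \<and> card S + 1 \<ge> CARD('p) \<and>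
       X = {y. dot y (rot w) \<in> Z} \<and> (card Z = 1 \<or> card Z = 2))"
proof (cases "\<exists>w. w \<noteq> 0 \<and> card ((\<lambda>x. dot x w) ` S) = 1")
  case True
  then obtain w where w: "w \<noteq> 0" "card ((\<lambda>x. dot x w) ` S) = 1" by blast
  then obtain c where c: "(\<lambda>x. dot x w) ` S = {c}" by (auto simp: card_1_singleton_iff)
  define Z where "Z = (\<lambda>y. dot y (rot w)) ` X"
  obtain x0 where x0: "x0 \<in> S" using ne by blast
  have Sc: "dot x w = c" if "x \<in> S" for x using c that by blast
  then have "{x \<in> S. dot x w = dot x0 w} = S" using x0 by auto
  then have sN: "card S + card Z \<ge> CARD('p) + 1"
    using line_boundD[OF SX w(1) x0] by (simp add: Z_def)
  \<comment> \<open>\<open>S\<close> meets one line only, so the bound for \<open>X\<close> demands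
    all points of each orthogonal line that meets \<open>X\<close>.\<close>
  have full: "{y \<in> X. dot y (rot w) = dot y0 (rot w)} = {y. dot y (rot w) = dot y0 (rot w)}"
    if "y0 \<in> X" for y0
  proof (rule card_subset_eq)
    have "card {y \<in> X. dot y (rot w) = dot y0 (rot w)} + card ((\<lambda>x. dot x (rot (rot w))) ` S) \<ge> CARD('p) + 1"
      using line_boundD[OF XS _ that, of "rot w"] w(1) by simp
    moreover have "card ((\<lambda>x. dot x (rot (rot w))) ` S) = 1"
      using card_projection_uminus[of w S] w(2) by simp
    ultimately have "card {y. dot y (rot w) = dot y0 (rot w)} \<le> card {y \<in> X. dot y (rot w) = dot y0 (rot w)}"
      using card_line[of "rot w" y0] w(1) by simp
    moreover have "card {y \<in> X. dot y (rot w) = dot y0 (rot w)} \<le> card {y. dot y (rot w) = dot y0 (rot w)}"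
      by (intro card_mono) auto
    ultimately show "card {y \<in> X. dot y (rot w) = dot y0 (rot w)} = card {y. dot y (rot w) = dot y0 (rot w)}"
      by simp
  qed auto
  then have X: "X = {y. dot y (rot w) \<in> Z}" unfolding Z_def by blast
  have Z0: "card Z > 0" using ne by (simp add: Z_def card_gt_0_iff)
  show ?thesis
  proof (cases "card Z \<ge> 3")
    case True
    have "card {y \<in> X. dot y (rot w) = dot y0 (rot w)} = CARD('p)" if "y0 \<in> X" for y0
      using full[OF that] card_line[of "rot w" y0] w(1) by simp
    then have "card X \<ge> card Z * CARD('p)"
      unfolding Z_def by (intro card_ge_fibers) auto
    then have "real (card X) \<ge> real (card Z) * real CARD('p)"
      by (metis of_nat_le_iff of_nat_mult)
    then show ?thesis using bound_full_lines[OF p True sN] by linarith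
  next
    case False
    then have "card Z = 1 \<or> card Z = 2" using Z0 by linarith
    \<comment> \<open>Two orthogonal lines in \<open>X\<close> allow one point of the line to be
      absent from \<open>S\<close>.\<close>
    moreover from this have "card S + 1 \<ge> CARD('p)" using sN by linarith
    moreover have "S \<subseteq> {x. dot x w = c}" using Sc by blast
    ultimately show ?thesis using w(1) X by blast
  qed
next
  case False
  obtain w where w: "w \<noteq> 0" "card ((\<lambda>x. dot x w) ` S) + 2 \<le> CARD('p)"
    using direction_missing_two_lines[OF p small] by blast
  define m where "m = card ((\<lambda>x. dot x w) ` S)"
  define N where "N = card ((\<lambda>y. dot y (rot w)) ` X)"
  define h where "h x0 = card {x \<in> S. dot x w = dot x0 w}" for x0
  \<comment> \<open>The smallest nonempty intersection of \<open>S\<close> with a line of the chosen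
    direction. A small \<open>\<mu>\<close> forces many orthogonal lines to meet \<open>X\<close>, a
    large one makes \<open>S\<close> large.\<close>
  define \<mu> where "\<mu> = Min (h ` S)"
  have "m \<noteq> 0" using ne by (simp add: m_def)
  moreover have "m \<noteq> 1" using False w(1) unfolding m_def by blast
  ultimately have m2: "2 \<le> m" by linarith
  have \<mu>: "\<mu> \<in> h ` S" unfolding \<mu>_def using ne by (intro Min_in) auto
  then obtain x0 where x0: "x0 \<in> S" "h x0 = \<mu>" by auto
  have N\<mu>: "\<mu> + N \<ge> CARD('p) + 1"
    using line_boundD[OF SX w(1) x0(1)] x0(2) by (simp add: N_def h_def)
  have "card S \<ge> m * \<mu>"
    unfolding m_def by (rule card_ge_fibers) (auto simp: \<mu>_def h_def[symmetric])
  have "card X \<ge> N * (CARD('p) + 1 - m)"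
    unfolding N_def
  proof (rule card_ge_fibers)
    fix y0 assume y0: "y0 \<in> X"
    have "card {y \<in> X. dot y (rot w) = dot y0 (rot w)} + card ((\<lambda>x. dot x (rot (rot w))) ` S) \<ge> CARD('p) + 1"
      using line_boundD[OF XS _ y0, of "rot w"] w(1) by simp
    then show "CARD('p) + 1 - m \<le> card {y \<in> X. dot y (rot w) = dot y0 (rot w)}"
      using card_projection_uminus[of w S] by (simp add: m_def)
  qed simp
  have "x0 \<in> {x \<in> S. dot x w = dot x0 w}" using x0 by simp
  then have "{x \<in> S. dot x w = dot x0 w} \<noteq> {}" by blast
  from card_gt_0_iff[THEN iffD2, OF conjI, OF this finite]
  have "\<mu> \<noteq> 0" unfolding x0(2)[symmetric] h_def by (rule gr_implies_not0)
  then consider "\<mu> = 1" | "2 \<le> \<mu>" by linarith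
  then show ?thesis
  proof cases
    case 1
    then have "CARD('p) \<le> N" using N\<mu> by simp
    then have "CARD('p) * (CARD('p) + 1 - m) \<le> N * (CARD('p) + 1 - m)" by (rule mult_le_mono1)
    then have "CARD('p) * (CARD('p) + 1 - m) \<le> card X"
      using \<open>card X \<ge> N * (CARD('p) + 1 - m)\<close> by linarith
    moreover have "m \<le> card S" using \<open>card S \<ge> m * \<mu>\<close> 1 by simp
    ultimately show ?thesis using bound_tangent[OF p] w(2) by (simp add: m_def)
  next
    case 2
    have "odd CARD('p)" using prime_odd_nat[OF prime_card[where 'a = 'p]] p by simp
    have "(real CARD('p) + 1 - real \<mu>) * (real CARD('p) + 1 - real m) \<le> real N * (real CARD('p) + 1 - real m)"
      using N\<mu> w(2) by (intro mult_right_mono) (auto simp: m_def)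
    also have "\<dots> = real (N * (CARD('p) + 1 - m))"
      using w(2) by (simp add: m_def of_nat_diff)
    also have "\<dots> \<le> real (card X)" using \<open>card X \<ge> N * (CARD('p) + 1 - m)\<close> by (simp only: of_nat_le_iff)
    finally show ?thesis
      using bound_no_tangent[OF p \<open>odd CARD('p)\<close> m2 2 \<open>card S \<ge> m * \<mu>\<close> small] by blast
  qed
qed

section \<open>Characters of the plane\<close>

declare split_paired_All [simp del] split_paired_Ex [simp del]

lemma dot_uminus_left: "dot (- x) w = - dot x w"
  by (simp add: dot_def)

lemma dot_zero_left [simp]: "dot 0 w = 0"
  by (simp add: dot_def)

lemma dot_add_right: "dot x (y + z) = dot x y + dot x z"
  by (simp add: dot_def algebra_simps)

lemma dot_nondegenerate:
  fixes y :: "'p::prime_card mod_ring \<times> 'p mod_ring"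
  assumes "\<And>x. dot x y = 0"
  shows "y = 0"
  using assms[of "(1, 0)"] assms[of "(0, 1)"] by (simp add: dot_def prod_eq_iff)

lemma ex_dot_eq:
  fixes w :: "'p::prime_card mod_ring \<times> 'p mod_ring"
  assumes "w \<noteq> 0"
  shows "\<exists>x. dot x w = z"
proof -
  obtain x where "dot x w \<noteq> 0" using dot_nondegenerate[of w] assms by blast
  then have "dot (scale (z / dot x w) x) w = z" by (simp add: dot_scale_left)
  then show ?thesis ..
qed

lemma line_nontrivial:
  fixes w :: "'p::prime_card mod_ring \<times> 'p mod_ring"
  assumes "w \<noteq> 0"
  shows "{x. dot x w = 0} \<noteq> {0}" "{x. dot x w = 0} \<noteq> UNIV"
proof -
  have "rot w \<in> {x. dot x w = 0}" "rot w \<noteq> 0" using assms by auto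
  then show "{x. dot x w = 0} \<noteq> {0}" by blast
  obtain x where "dot x w = 1" using ex_dot_eq[OF assms] by blast
  then have "x \<notin> {x. dot x w = 0}" by simp
  then show "{x. dot x w = 0} \<noteq> UNIV" by blast
qed

lemma line_rcoset:
  fixes w :: "'p::prime_card mod_ring \<times> 'p mod_ring"
  assumes "w \<noteq> 0"
  shows "{x. dot x w = z} \<in> rcosets\<^bsub>additive_group\<^esub> {x. dot x w = 0}"
proof -
  obtain x0 where x0: "dot x0 w = z" using ex_dot_eq[OF assms] by blast
  have "x \<in> {x. dot x w = 0} #>\<^bsub>additive_group\<^esub> x0 \<longleftrightarrow> dot x w = z" for x
    using x0 by (auto simp: r_coset_def additive_group_def dot_add_left dot_diff_left
        intro!: exI[of _ "x - x0"])
  then show ?thesis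
    by (auto simp: RCOSETS_def additive_group_def intro!: exI[of _ x0])
qed

lemma subgroup_line:
  fixes w :: "'p::prime_card mod_ring \<times> 'p mod_ring"
  shows "subgroup {x. dot x w = 0} additive_group"
proof -
  interpret comm_group "additive_group :: ('p mod_ring \<times> 'p mod_ring) monoid"
    by (rule comm_group_additive_group)
  show ?thesis
  proof (rule subgroupI)
    fix a assume "a \<in> {x. dot x w = 0}"
    moreover have "inv\<^bsub>additive_group\<^esub> a = - a"
      by (rule inv_equality) (auto simp: additive_group_def)
    ultimately show "inv\<^bsub>additive_group\<^esub> a \<in> {x. dot x w = 0}" by (simp add: dot_uminus_left)
  next
    have "0 \<in> {x. dot x w = 0}" by simp
    then show "{x. dot x w = 0} \<noteq> {}" by blast
  qed (auto simp: additive_group_def dot_add_left)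
qed

lemma dot_diff_right: "dot x (y - z) = dot x y - dot x z"
  by (simp add: dot_def algebra_simps)

section \<open>Additive characters and the dual group of the plane\<close>

lemma ex_add_char:
  assumes p: "CARD('p::prime_card) \<ge> 3"
  shows "\<exists>e :: 'p mod_ring \<Rightarrow> complex. add_char e"
proof -
  define \<zeta> where "\<zeta> = cis (2 * pi / CARD('p))"
  define e where "e x = \<zeta> ^ nat (to_int_mod_ring x)" for x :: "'p mod_ring"
  have "\<zeta> ^ CARD('p) = 1"
    unfolding \<zeta>_def using p by (simp add: DeMoivre)
  then have mod: "\<zeta> ^ (n mod CARD('p)) = \<zeta> ^ n" for n
    by (metis mult_div_mod_eq power_add power_mult power_one mult_1)
  have nonneg: "to_int_mod_ring x \<ge> 0" for x :: "'p mod_ring"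
    using range_to_int_mod_ring[where 'a = 'p] by (metis atLeastLessThan_iff rangeI)
  have "e (x + y) = e x * e y" for x y
  proof -
    have "nat (to_int_mod_ring (x + y)) = (nat (to_int_mod_ring x) + nat (to_int_mod_ring y)) mod CARD('p)"
      using nonneg[of x] nonneg[of y] by (simp add: to_int_mod_ring_add nat_mod_distrib nat_add_distrib)
    then show ?thesis by (simp add: e_def mod power_add)
  qed
  moreover have "e 0 = 1" by (simp add: e_def)
  moreover have "e 1 \<noteq> 1"
  proof
    assume "e 1 = 1"
    then have "cis (2 * pi / CARD('p)) = 1" by (simp add: e_def \<zeta>_def)
    then have "sin (2 * pi / CARD('p)) = 0" by (metis Im_complex_of_real cis.sel(2) one_complex.simps(2))
    \<comment> \<open>The angle lies strictly below \<open>pi\<close> because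
      \<open>CARD('p) \<ge> 3\<close>.\<close>
    moreover have "sin (2 * pi / CARD('p)) > 0"
      using p pi_gt_zero by (intro sin_gt_zero) (auto simp: field_simps)
    ultimately show False by simp
  qed
  ultimately show ?thesis unfolding add_char_def by blast
qed

lemma sum_e_dot:
  fixes e :: "'p::prime_card mod_ring \<Rightarrow> complex"
  assumes e: "add_char e"
  shows "(\<Sum>y\<in>UNIV. e (dot y x)) = (if x = 0 then of_nat CARD('p) ^ 2 else 0)"
proof -
  have "(\<Sum>y\<in>UNIV. e (dot y x)) = (\<Sum>a\<in>UNIV. \<Sum>b\<in>UNIV. e (a * fst x) * e (b * snd x))"
    by (simp add: sum.cartesian_product UNIV_Times_UNIV dot_def e_add[OF e] case_prod_unfold)
  also have "\<dots> = (\<Sum>a\<in>UNIV. e (a * fst x)) * (\<Sum>b\<in>UNIV. e (b * snd x))"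
    by (simp add: sum_product)
  finally show ?thesis
    by (simp add: sum_e_mult[OF e] power2_eq_square prod_eq_iff)
qed

text \<open>An injective map from \<open>CARD('p)\<close> elements into the equally many roots of
  unity is onto. This lets values of arbitrary characters be written through
  \<open>e\<close>.\<close>

lemma add_char_roots_of_unity:
  fixes e :: "'p::prime_card mod_ring \<Rightarrow> complex"
  assumes e: "add_char e"
  shows "range e = {z. z ^ CARD('p) = 1}"
proof (rule card_subset_eq)
  have "CARD('p) > 0" by simp
  then show "finite {z::complex. z ^ CARD('p) = 1}" by (intro finite_roots_unity) simp
  have "e x ^ CARD('p) = 1" for x
    using e_mult_of_nat[OF e, of "CARD('p)" x] by (simp add: e_0[OF e])
  then show "range e \<subseteq> {z. z ^ CARD('p) = 1}" by auto
  have "inj e"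
  proof (rule injI)
    fix x y assume "e x = e y"
    then have "e (x - y) = 1"
      using e_add[OF e, of "x - y" y] e_nonzero[OF e, of y] by simp
    then show "x = y" using e_eq_1[OF e] by fastforce
  qed
  then show "card (range e) = card {z::complex. z ^ CARD('p) = 1}"
    by (simp add: card_image card_roots_unity_eq)
qed

lemma cnj_add_char:
  fixes e :: "'p::prime_card mod_ring \<Rightarrow> complex"
  assumes e: "add_char e"
  shows "cnj (e x) = e (- x)"
proof -
  have "e x ^ CARD('p) = 1" using add_char_roots_of_unity[OF e] by auto
  then have "norm (e x) ^ CARD('p) = 1" by (metis norm_one norm_power)
  then have "norm (e x) = 1"
    using power_eq_imp_eq_base[of "norm (e x)" "CARD('p)" 1] by simp
  then have "e x * cnj (e x) = e x * e (- x)"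
    using e_add[OF e, of x "- x"] e_0[OF e] by (simp add: complex_norm_square[symmetric])
  then show ?thesis using e_nonzero[OF e] by simp
qed

text \<open>For a nontrivial additive character \<open>e\<close> this identifies the plane with its
  dual, so that sets of characters become point sets.\<close>

definition character :: "('p::prime_card mod_ring \<Rightarrow> complex) \<Rightarrow> 'p mod_ring \<times> 'p mod_ring
    \<Rightarrow> 'p mod_ring \<times> 'p mod_ring \<Rightarrow> complex" where
  "character e y = (\<lambda>x. e (dot x y))"

context
  fixes e :: "'p::prime_card mod_ring \<Rightarrow> complex"
  assumes e: "add_char e"
begin

lemma inj_character: "inj (character e)"
proof (rule injI)
  fix y y' assume eq: "character e y = character e y'"
  have "dot x (y - y') = 0" for x
  proof -
    have "e (dot x y) = e (dot x y')" using fun_cong[OF eq, of x] by (simp add: character_def)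
    moreover have "e (dot x y) = e (dot x (y - y')) * e (dot x y')"
      by (simp add: e_add[OF e, symmetric] dot_commute[of x] dot_diff_left)
    ultimately show ?thesis using e_nonzero[OF e] e_eq_1[OF e] by simp
  qed
  then have "y - y' = 0" by (rule dot_nondegenerate)
  then show "y = y'" by simp
qed

lemma character_mult: "(\<lambda>x. character e y x * character e y' x) = character e (y + y')"
  by (simp add: character_def dot_add_right e_add[OF e])

text \<open>A character is determined by its values on the two unit vectors; these are roots of
  unity of order dividing \<open>CARD('p)\<close>, hence of the form \<open>e a\<close> and
  \<open>e b\<close>.\<close>

lemma range_character: "range (character e) = carrier dual_group"
proof
  show "range (character e) \<subseteq> carrier dual_group"
    by (rule image_subsetI) (simp add: dual_group_def hom_def additive_group_def complex_units_def
        character_def dot_add_left e_add[OF e] e_nonzero[OF e] del: split_paired_All)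
  show "carrier dual_group \<subseteq> range (character e)"
  proof
    fix \<chi> :: "'p mod_ring \<times> 'p mod_ring \<Rightarrow> complex"
    assume "\<chi> \<in> carrier dual_group"
    then have "\<forall>x y. \<chi> (x + y) = \<chi> x * \<chi> y" "\<forall>x. \<chi> x \<noteq> 0"
      by (simp_all add: dual_group_def hom_def additive_group_def complex_units_def Pi_iff
          del: split_paired_All)
    then have mult: "\<chi> (x + y) = \<chi> x * \<chi> y" and nz: "\<chi> x \<noteq> 0" for x y
      by blast+
    have \<chi>0: "\<chi> 0 = 1" using mult[of 0 0] nz[of 0] by simp
    have pow: "\<chi> (scale (of_nat n) x) = \<chi> x ^ n" for n x
    proof (induction n)
      case (Suc n)
      have "scale (of_nat (Suc n)) x = x + scale (of_nat n) x"
        by (simp add: scale_def prod_eq_iff algebra_simps)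
      then show ?case by (simp add: mult Suc)
    qed (use \<chi>0 in \<open>simp add: scale_def zero_prod_def\<close>)
    have root: "\<chi> x \<in> range e" for x
    proof -
      have "scale (of_nat CARD('p)) x = 0" by (simp add: scale_def zero_prod_def)
      then have "\<chi> x ^ CARD('p) = 1" using pow[of "CARD('p)" x] \<chi>0 by simp
      then show ?thesis unfolding add_char_roots_of_unity[OF e] by simp
    qed
    obtain a b where ab: "\<chi> (1, 0) = e a" "\<chi> (0, 1) = e b"
      using root by (metis rangeE)
    have "\<chi> x = character e (a, b) x" for x
    proof -
      obtain i j where ij: "fst x = of_nat i" "snd x = of_nat j"
        using surj_of_nat_mod_ring by metis
      have "x = scale (of_nat i) (1, 0) + scale (of_nat j) (0, 1)"
        using ij by (simp add: scale_def prod_eq_iff)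
      then have "\<chi> x = e a ^ i * e b ^ j" by (simp add: mult pow ab)
      also have "\<dots> = e (dot x (a, b))"
        by (simp add: dot_def ij e_add[OF e] e_mult_of_nat[OF e])
      finally show ?thesis by (simp add: character_def)
    qed
    then have "\<chi> = character e (a, b)" by (rule ext)
    then show "\<chi> \<in> range (character e)" by simp
  qed
qed

text \<open>This is the shape that \<open>line_bound_transform\<close> expects, with the conjugate
  character and \<open>f\<close> rescaled by the order of the plane.\<close>

lemma fourier_character:
  "fourier f (character e y) = (\<Sum>x\<in>UNIV. f x / of_nat CARD('p) ^ 2 * e (- dot y x))"
  unfolding fourier_def sum_distrib_left
proof (intro sum.cong refl)
  fix x
  have "cnj (character e y x) = e (- dot y x)"
    by (simp add: character_def cnj_add_char[OF e] dot_commute[of x])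
  then show "1 / of_nat CARD('p mod_ring \<times> 'p mod_ring) * (f x * cnj (character e y x))
      = f x / of_nat CARD('p) ^ 2 * e (- dot y x)"
    by (simp add: power2_eq_square)
qed

lemma fourier_inversion:
  "f x = (\<Sum>y\<in>UNIV. fourier f (character e y) * e (dot x y))"
proof -
  have "(\<Sum>y\<in>UNIV. fourier f (character e y) * e (dot x y))
      = (\<Sum>y\<in>UNIV. \<Sum>z\<in>UNIV. f z / of_nat CARD('p) ^ 2 * e (dot y (x - z)))"
    unfolding fourier_character sum_distrib_right
  proof (intro sum.cong refl)
    fix y z
    have "e (dot y (x - z)) = e (- dot y z) * e (dot x y)"
      by (simp add: dot_diff_right dot_commute[of x] flip: e_add[OF e])
    then show "f z / of_nat CARD('p) ^ 2 * e (- dot y z) * e (dot x y)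
        = f z / of_nat CARD('p) ^ 2 * e (dot y (x - z))"
      by simp
  qed
  also have "\<dots> = (\<Sum>z\<in>UNIV. f z / of_nat CARD('p) ^ 2 * (\<Sum>y\<in>UNIV. e (dot y (x - z))))"
    by (subst sum.swap) (simp add: sum_distrib_left)
  also have "\<dots> = (\<Sum>z\<in>UNIV. if z = x then f z else 0)"
    by (intro sum.cong refl) (auto simp: sum_e_dot[OF e])
  finally show ?thesis by simp
qed

text \<open>Inversion and the transform itself have the same form, so one lemma gives both bounds.
  The second uses the conjugate of \<open>e\<close>; the rescaling leaves the support
  unchanged.\<close>

lemma line_bounds_fourier:
  shows "line_bound {x. f x \<noteq> 0} {y. fourier f (character e y) \<noteq> 0}"
    and "line_bound {y. fourier f (character e y) \<noteq> 0} {x. f x \<noteq> 0}"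
proof -
  show "line_bound {x. f x \<noteq> 0} {y. fourier f (character e y) \<noteq> 0}"
    by (rule line_bound_transform[OF e]) (rule fourier_inversion)
  have "add_char (\<lambda>x. e (- x))"
    using e_eq_1[OF e, of "- 1"] by (auto simp: add_char_def e_0[OF e] e_add[OF e, symmetric])
  from line_bound_transform[OF this fourier_character]
  show "line_bound {y. fourier f (character e y) \<noteq> 0} {x. f x \<noteq> 0}" by simp
qed

text \<open>The line is spanned by \<open>rot w\<close> and \<open>e\<close> is \<open>1\<close>
  only at \<open>0\<close>. Both \<open>orth\<close> and \<open>dual_orth\<close> of a line are
  computed from this.\<close>

lemma character_eq_1_on_line_iff:
  assumes "w \<noteq> 0"
  shows "(\<forall>x. dot x w = 0 \<longrightarrow> e (dot x y) = 1) \<longleftrightarrow> dot y (rot w) = 0"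
proof -
  have "e z = 1 \<longleftrightarrow> z = 0" for z using e_eq_1[OF e] e_0[OF e] by auto
  then have "(\<forall>x. dot x w = 0 \<longrightarrow> e (dot x y) = 1) \<longleftrightarrow> (\<forall>t. t * dot (rot w) y = 0)"
    using dot_eq_0_iff_scale_rot[OF assms] by (auto simp: dot_scale_left)
  also have "\<dots> \<longleftrightarrow> dot y (rot w) = 0"
    by (metis dot_commute mult.left_neutral mult_zero_right)
  finally show ?thesis .
qed

lemma orth_line:
  assumes "w \<noteq> 0"
  shows "orth {x. dot x w = 0} = character e ` {y. dot y (rot w) = 0}"
proof -
  have "character e y \<in> orth {x. dot x w = 0} \<longleftrightarrow> dot y (rot w) = 0" for y
  proof -
    have "character e y \<in> carrier dual_group" using range_character by blast
    then have "character e y \<in> orth {x. dot x w = 0} \<longleftrightarrow> (\<forall>x. dot x w = 0 \<longrightarrow> e (dot x y) = 1)"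
      by (auto simp: orth_def kernel_def additive_group_def complex_units_def character_def)
    then show ?thesis using character_eq_1_on_line_iff[OF assms] by simp
  qed
  moreover have "orth {x. dot x w = 0} \<subseteq> range (character e)"
    unfolding range_character by (auto simp: orth_def)
  ultimately show ?thesis by blast
qed

lemma dual_orth_line:
  assumes "w \<noteq> 0"
  shows "dual_orth (character e ` {y. dot y w = 0}) = {x. dot x (rot w) = 0}"
proof -
  have "x \<in> dual_orth (character e ` {y. dot y w = 0}) \<longleftrightarrow> (\<forall>y. dot y w = 0 \<longrightarrow> e (dot y x) = 1)" for x
    by (auto simp: dual_orth_def kernel_def additive_group_def complex_units_def character_def
        dot_commute[of x])
  then show ?thesis using character_eq_1_on_line_iff[OF assms] by auto
qed

lemma character_line_rcoset:
  fixes w :: "'p mod_ring \<times> 'p mod_ring"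
  assumes "w \<noteq> 0"
  shows "character e ` {x. dot x w = z} \<in> rcosets\<^bsub>dual_group\<^esub> (character e ` {x. dot x w = 0})"
proof -
  obtain x0 where x0: "dot x0 w = z" using ex_dot_eq[OF assms] by blast
  have "{x. dot x w = z} = (\<lambda>x. x + x0) ` {x. dot x w = 0}"
  proof (intro equalityI subsetI)
    fix x assume "x \<in> {x. dot x w = z}"
    then show "x \<in> (\<lambda>x. x + x0) ` {x. dot x w = 0}"
      using x0 by (intro image_eqI[of _ _ "x - x0"]) (simp_all add: dot_diff_left)
  qed (use x0 in \<open>auto simp: dot_add_left\<close>)
  then have "character e ` {x. dot x w = z} = character e ` {x. dot x w = 0} #>\<^bsub>dual_group\<^esub> character e x0"
    by (auto simp: r_coset_def dual_group_def character_mult image_image)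
  moreover have "character e x0 \<in> carrier dual_group" using range_character by blast
  ultimately show ?thesis by (auto simp: RCOSETS_def)
qed

lemma subgroup_character_line:
  fixes w :: "'p mod_ring \<times> 'p mod_ring"
  shows "subgroup (character e ` {x. dot x w = 0}) dual_group"
proof -
  interpret comm_group "dual_group :: ('p mod_ring \<times> 'p mod_ring \<Rightarrow> complex) monoid"
    by (rule comm_group_dual_group)
  have one: "character e 0 = \<one>\<^bsub>dual_group\<^esub>"
    by (simp add: character_def dual_group_def dot_def e_0[OF e])
  have mult: "character e x \<otimes>\<^bsub>dual_group\<^esub> character e y = character e (x + y)" for x y
    by (simp add: dual_group_def character_mult)
  have carr: "character e x \<in> carrier dual_group" for x using range_character by blast
  show ?thesis
  proof (rule subgroupI)
    fix a assume "a \<in> character e ` {x. dot x w = 0}"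
    then obtain x where x: "a = character e x" "dot x w = 0" by auto
    have "inv\<^bsub>dual_group\<^esub> a = character e (- x)"
      by (rule inv_equality) (auto simp: x(1) mult one carr)
    moreover have "dot (- x) w = 0" using x(2) by (simp add: dot_uminus_left)
    ultimately show "inv\<^bsub>dual_group\<^esub> a \<in> character e ` {x. dot x w = 0}" by auto
  next
    fix a b assume "a \<in> character e ` {x. dot x w = 0}" "b \<in> character e ` {x. dot x w = 0}"
    then obtain x y where "a = character e x" "b = character e y" "dot x w = 0" "dot y w = 0" by blast
    then show "a \<otimes>\<^bsub>dual_group\<^esub> b \<in> character e ` {x. dot x w = 0}"
      by (intro image_eqI[of _ _ "x + y"]) (simp_all add: mult dot_add_left)
  next
    have "character e 0 \<in> character e ` {x. dot x w = 0}" by (rule imageI) simp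
    then show "character e ` {x. dot x w = 0} \<noteq> {}" by blast
  qed (use carr in auto)
qed

end

section \<open>From lines to cosets, and the final assembly\<close>

lemma coset_up_to_oneI:
  assumes "C \<in> rcosets\<^bsub>G\<^esub> H" "finite C" "A \<subseteq> C" "card C \<le> card A + 1"
  shows "coset_up_to_one G H A"
proof (cases "A = C")
  case False
  then obtain c where c: "c \<in> C" "c \<notin> A" using assms(3) by blast
  have "A = C - {c}"
    by (rule card_seteq) (use c assms in \<open>auto simp: card_Diff_singleton\<close>)
  then show ?thesis using assms(1) c(1) unfolding coset_up_to_one_def by blast
qed (use assms(1) in \<open>auto simp: coset_up_to_one_def\<close>)

lemma one_or_two_cosetsI:
  assumes "\<And>z. K z \<in> rcosets\<^bsub>G\<^esub> H" "inj K" "card Z = 1 \<or> card Z = 2"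
  shows "one_or_two_cosets G H (\<Union>z\<in>Z. K z)"
  using assms(3)
proof
  assume "card Z = 1"
  then obtain z where "Z = {z}" by (rule card_1_singletonE)
  then show ?thesis using assms(1) by (simp add: one_or_two_cosets_def)
next
  assume "card Z = 2"
  then obtain z z' where "Z = {z, z'}" "z \<noteq> z'" by (auto simp: card_2_iff)
  then show ?thesis using assms(1,2) unfolding one_or_two_cosets_def
    by (intro disjI2 bexI[of _ "K z"] bexI[of _ "K z'"]) (auto dest: injD)
qed

theorem theorem3:
  fixes p :: nat
    and f :: "'p::prime_card mod_ring \<times> 'p mod_ring \<Rightarrow> complex"
    and S :: "('p mod_ring \<times> 'p mod_ring) set"
    and X :: "('p mod_ring \<times> 'p mod_ring \<Rightarrow> complex) set"
  assumes "p = CARD('p)" and "p \<ge> 3"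
    and "\<exists>g. f g \<noteq> 0"
    and "S = supp_on (carrier additive_group) f"
    and "X = supp_on (carrier dual_group) (fourier f)"
  shows "1 / (real p - 2) * real (min (card S) (card X))
           + 1 / 3 * real (max (card S) (card X)) \<ge> real p + 1
       \<or> real (min (card S) (card X)) \<ge> 3 / 2 * (real p - 1)
       \<or> card S \<le> card X \<and> coset_pair additive_group dual_group orth S X
       \<or> card X \<le> card S \<and> coset_pair dual_group additive_group dual_orth X S"
proof (rule ccontr)
  assume neg: "\<not> ?thesis"
  have p: "CARD('p) \<ge> 3" using assms(1,2) by simp
  obtain e :: "'p mod_ring \<Rightarrow> complex" where e: "add_char e" using ex_add_char[OF p] by blast
  \<comment> \<open>\<open>X\<close> in the coordinates given by \<open>character e\<close>; both
    supports now lie in the same plane.\<close>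
  define Y where "Y = {y. fourier f (character e y) \<noteq> 0}"
  have S: "S = {x. f x \<noteq> 0}" using assms(4) by (simp add: supp_on_def additive_group_def)
  have XY: "X = character e ` Y"
    unfolding assms(5) supp_on_def range_character[OF e, symmetric] Y_def by auto
  have cX: "card X = card Y"
    unfolding XY using inj_character[OF e] by (intro card_image) (auto intro: inj_on_subset)
  have ne: "S \<noteq> {}" using assms(3) by (auto simp: S)
  have neY: "Y \<noteq> {}"
  proof
    assume "Y = {}"
    then have "fourier f (character e y) = 0" for y by (auto simp: Y_def)
    then have "f x = 0" for x using fourier_inversion[OF e, of f x] by simp
    then show False using assms(3) by blast
  qed
  have SY: "line_bound S Y" "line_bound Y S"
    unfolding S Y_def by (rule line_bounds_fourier[OF e] line_bounds_fourier(2)[OF e])+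
  have small: "2 * n < 3 * (CARD('p) - 1)" if "\<not> 3 / 2 * (real p - 1) \<le> real n" for n :: nat
  proof -
    have "real (2 * n) < real (3 * (CARD('p) - 1))"
      using that p assms(1) by (simp add: of_nat_diff)
    then show ?thesis by (simp only: of_nat_less_iff)
  qed
  have inj_lines: "inj (\<lambda>z. {x. dot x w = z})" if w0: "w \<noteq> 0" for w :: "'p mod_ring \<times> 'p mod_ring"
  proof (rule injI)
    fix z z' assume eq: "{x. dot x w = z} = {x. dot x w = z'}"
    obtain x where "dot x w = z" using ex_dot_eq[OF w0] by blast
    then show "z = z'" using eq by blast
  qed
  have inj_char_lines: "inj (\<lambda>z. character e ` {x. dot x w = z})" if w0: "w \<noteq> 0" for w
  proof (rule injI)
    fix z z' assume "character e ` {x. dot x w = z} = character e ` {x. dot x w = z'}"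
    then have "{x. dot x w = z} = {x. dot x w = z'}"
      by (simp only: inj_image_eq_iff[OF inj_character[OF e]])
    then show "z = z'" by (rule injD[OF inj_lines[OF w0]])
  qed
  have fin_line: "card {x. dot x w = z} = CARD('p)" if w0: "w \<noteq> 0" for w :: "'p mod_ring \<times> 'p mod_ring" and z
  proof -
    obtain x0 where "dot x0 w = z" using ex_dot_eq[OF w0] by blast
    then show ?thesis using card_line[OF w0, of x0] by simp
  qed
  show False
  proof (cases "card S \<le> card X")
    case True
    \<comment> \<open>Both inequalities are negated, which leaves the exceptional alternative of the
      dichotomy.\<close>
    then have "\<exists>w c Z. w \<noteq> 0 \<and> S \<subseteq> {x. dot x w = c} \<and> card S + 1 \<ge> CARD('p) \<and>
       Y = {y. dot y (rot w) \<in> Z} \<and> (card Z = 1 \<or> card Z = 2)"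
      using small_support_dichotomy[OF p ne neY SY] small[of "card S"] neg cX assms(1)
      by (simp add: min_def max_def)
    then obtain w c Z where w: "w \<noteq> 0" "S \<subseteq> {x. dot x w = c}" "card S + 1 \<ge> CARD('p)"
       "Y = {y. dot y (rot w) \<in> Z}" "card Z = 1 \<or> card Z = 2" by blast
    have rw: "rot w \<noteq> 0" using w(1) by simp
    have "coset_up_to_one additive_group {x. dot x w = 0} S"
      by (rule coset_up_to_oneI[OF line_rcoset[OF w(1)]]) (use w(2,3) fin_line[OF w(1)] in auto)
    moreover have "X = (\<Union>z\<in>Z. character e ` {x. dot x (rot w) = z})"
      unfolding XY w(4) by blast
    then have "one_or_two_cosets dual_group (orth {x. dot x w = 0}) X"
      unfolding orth_line[OF e w(1)]
      using one_or_two_cosetsI[OF character_line_rcoset[OF e rw] inj_char_lines[OF rw] w(5)] by simp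
    ultimately have "coset_pair additive_group dual_group orth S X"
      unfolding coset_pair_def using subgroup_line[of w] line_nontrivial[OF w(1)]
      by (intro exI[of _ "{x. dot x w = 0}"]) (simp add: additive_group_def)
    then show False using neg True by blast
  next
    case False
    \<comment> \<open>The same dichotomy with the supports exchanged; the subgroup now lies in the
      dual and is transported by \<open>character e\<close>.\<close>
    then have "\<exists>w c Z. w \<noteq> 0 \<and> Y \<subseteq> {x. dot x w = c} \<and> card Y + 1 \<ge> CARD('p) \<and>
       S = {y. dot y (rot w) \<in> Z} \<and> (card Z = 1 \<or> card Z = 2)"
      using small_support_dichotomy[OF p neY ne SY(2,1)] small[of "card X"] neg cX assms(1)
      by (simp add: min_def max_def)
    then obtain w c Z where w: "w \<noteq> 0" "Y \<subseteq> {x. dot x w = c}" "card Y + 1 \<ge> CARD('p)"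
       "S = {y. dot y (rot w) \<in> Z}" "card Z = 1 \<or> card Z = 2" by blast
    have rw: "rot w \<noteq> 0" using w(1) by simp
    have "card (character e ` {x. dot x w = c}) = CARD('p)"
      using fin_line[OF w(1)] inj_character[OF e] by (subst card_image) (auto intro: inj_on_subset)
    then have "coset_up_to_one dual_group (character e ` {x. dot x w = 0}) X"
      by (intro coset_up_to_oneI[OF character_line_rcoset[OF e w(1), of c]]) (use w(2,3) cX XY in auto)
    moreover have "S = (\<Union>z\<in>Z. {x. dot x (rot w) = z})"
      unfolding w(4) by blast
    then have "one_or_two_cosets additive_group (dual_orth (character e ` {x. dot x w = 0})) S"
      unfolding dual_orth_line[OF e w(1)]
      using one_or_two_cosetsI[OF line_rcoset[OF rw] inj_lines[OF rw] w(5)] by simp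
    moreover have "character e ` {x. dot x w = 0} \<noteq> {\<one>\<^bsub>dual_group\<^esub>}"
    proof
      have one: "character e 0 = \<one>\<^bsub>dual_group\<^esub>"
        by (simp add: character_def dual_group_def dot_def e_0[OF e])
      assume "character e ` {x. dot x w = 0} = {\<one>\<^bsub>dual_group\<^esub>}"
      then have "character e ` {x. dot x w = 0} = character e ` {0}" by (simp add: one)
      then have "{x. dot x w = 0} = {0}"
        by (simp only: inj_image_eq_iff[OF inj_character[OF e]])
      then show False using line_nontrivial(1)[OF w(1)] by contradiction
    qed
    moreover have "character e ` {x. dot x w = 0} \<noteq> carrier dual_group"
    proof
      assume "character e ` {x. dot x w = 0} = carrier dual_group"
      then have "{x. dot x w = 0} = UNIV"
        unfolding range_character[OF e, symmetric]
        by (simp only: inj_image_eq_iff[OF inj_character[OF e]])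
      then show False using line_nontrivial(2)[OF w(1)] by contradiction
    qed
    ultimately have "coset_pair dual_group additive_group dual_orth X S"
      unfolding coset_pair_def using subgroup_character_line[OF e, of w]
      by (intro exI[of _ "character e ` {x. dot x w = 0}"]) simp
    then show False using neg False by simp
  qed
qed

end
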